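(* Let $d_1,d_2\ge1$ be integers, let $\boldsymbol\gamma=(\gamma_1,\dots,\gamma_{d_1})\in\mathbb{R}^{d_1}$ with $\gamma_i>-1$ for $1\le i\le d_1$, and let $\boldsymbol\kappa=(\kappa_1,\dots,\kappa_{d_2+1})\in\mathbb{R}^{d_2+1}$ with $\kappa_i>-1$ for $1\le i\le d_2+1$. Put $\mathfrak{L}_{\boldsymbol\gamma}^{(x)}=\sum_{i=1}^{d_1}\big[x_i\partial_{x_i}^2+(\gamma_i+1)\partial_{x_i}\big]$ and $\mathfrak{L}_{\boldsymbol\kappa}^{(y)}=\sum_{i=1}^{d_2}\big[y_i\partial_{y_i}^2+(\kappa_i+1)\partial_{y_i}\big]$, and define $$ \begin{aligned} \mathfrak{D}_{\boldsymbol\gamma,\boldsymbol\kappa}^{L\rtimes\triangle}:={}&-(1-|y|)\big(\mathfrak{L}_{\boldsymbol\gamma}^{(x)}\big)^2+\mathfrak{L}_{\boldsymbol\gamma}^{(x)}\langle x,\nabla_x\rangle+\langle x,\nabla_x\rangle\mathfrak{L}_{\boldsymbol\gamma}^{(x)}+(\kappa_{d_2+1}+|\boldsymbol\gamma|+d_1)\mathfrak{L}_{\boldsymbol\gamma}^{(x)}+\mathfrak{L}_{\boldsymbol\kappa}^{(y)}\\ &-\big(\langle x,\nabla_x\rangle+\langle y,\nabla_y\rangle\big)^2-(|\boldsymbol\kappa|+|\boldsymbol\gamma|+d_1+d_2)\big(\langle x,\nabla_x\rangle+\langle y,\nabla_y\rangle\big). \end{aligned} $$ Then, for each $n\in\mathbb{N}_0$,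 $\mathcal{V}_n\big(\mathbb{R}_+^{d_1}\rtimes\triangle^{d_2},W_{\boldsymbol\gamma,\boldsymbol\kappa}^{L\rtimes\triangle}\big)$ is an eigenspace of $\mathfrak{D}_{\boldsymbol\gamma,\boldsymbol\kappa}^{L\rtimes\triangle}$; more precisely, $$ \mathfrak{D}_{\boldsymbol\gamma,\boldsymbol\kappa}^{L\rtimes\triangle}u=-n\big(n+|\boldsymbol\kappa|+|\boldsymbol\gamma|+d_1+d_2\big)u\qquad\text{for all }u\in\mathcal{V}_n\big(\mathbb{R}_+^{d_1}\rtimes\triangle^{d_2},W_{\boldsymbol\gamma,\boldsymbol\kappa}^{L\rtimes\triangle}\big). $$
   Context: Variables are $(x,y)\in\mathbb{R}^{d_1}\times\mathbb{R}^{d_2}$; for a vector, $|\cdot|$ denotes the sum of its entries: $|x|=\sum_{i=1}^{d_1}x_i$, $|y|=\sum_{i=1}^{d_2}y_i$, $|\boldsymbol\gamma|=\sum_{i=1}^{d_1}\gamma_i$, $|\boldsymbol\kappa|=\sum_{i=1}^{d_2+1}\kappa_i$. $\langle x,\nabla_x\rangle=\sum_ix_i\partial_{x_i}$, $\langle y,\nabla_y\rangle=\sum_iy_i\partial_{y_i}$, and products and powers of operators mean composition. $\mathbb{R}_+=[0,\infty)$ and $\triangle^{d}=\{y\in\mathbb{R}^d:y_1\ge0,\dots,y_d\ge0,\ |y|\le1\}$. The domain is $\mathbb{R}_+^{d_1}\rtimes\triangle^{d_2}=\mathbb{R}_+^{d_1}\times\triangle^{d_2}$ with weight $W_{\boldsymbol\gamma,\boldsymbol\kappa}^{L\rtimes\triangle}(x,y)=\prod_{i=1}^{d_2}y_i^{\kappa_i}\,(1-|y|)^{\kappa_{d_2+1}}\prod_{i=1}^{d_1}x_i^{\gamma_i}\,e^{-\frac{|x|}{1-|y|}}$.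 For a weight $W$ on $\Omega$, $\mathcal{V}_n(\Omega,W)$ is the space of real polynomials of degree $n$ (together with $0$) orthogonal to all polynomials of degree less than $n$ with respect to $\int_\Omega fg\,W$. *)

theory Defs
  imports "HOL-Analysis.Analysis"
begin

type_synonym ('m, 'n) dom = "(real ^ 'm) \<times> (real ^ 'n)"

definition entry_sum :: "real ^ 'k::finite \<Rightarrow> real" where
  "entry_sum v = (\<Sum>i\<in>UNIV. v $ i)"

text \<open>Polynomials are polynomial functions, \<^const>\<open>real_polynomial_function\<close>. The library
  has no total degree for these, so it is defined through the expansion in monomials.\<close>

definition monomial_fun ::
    "('m::finite \<Rightarrow> nat) \<times> ('n::finite \<Rightarrow> nat) \<Rightarrow> ('m, 'n) dom \<Rightarrow> real" where
  "monomial_fun = (\<lambda>(\<alpha>, \<beta>) (x, y). (\<Prod>i\<in>UNIV. (x $ i) ^ \<alpha> i) * (\<Prod>j\<in>UNIV. (y $ j) ^ \<beta> j))"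

definition multi_indices_le :: "nat \<Rightarrow> (('m::finite \<Rightarrow> nat) \<times> ('n::finite \<Rightarrow> nat)) set" where
  "multi_indices_le N = {(\<alpha>, \<beta>). sum \<alpha> UNIV + sum \<beta> UNIV \<le> N}"

definition polys_le :: "nat \<Rightarrow> (('m::finite, 'n::finite) dom \<Rightarrow> real) set" where
  "polys_le N = {f. \<exists>c. f = (\<lambda>z. \<Sum>a\<in>multi_indices_le N. c a * monomial_fun a z)}"

text \<open>The zero polynomial gets degree 0.\<close>

definition total_degree :: "(('m::finite, 'n::finite) dom \<Rightarrow> real) \<Rightarrow> nat" where
  "total_degree f = (LEAST N. f \<in> polys_le N)"

text \<open>The Lebesgue integral of a non-integrable function is 0 by convention; this is meant for
  weights all of whose polynomial moments exist.\<close>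

definition orth_polys ::
    "nat \<Rightarrow> ('m::finite, 'n::finite) dom set \<Rightarrow> (('m, 'n) dom \<Rightarrow> real) \<Rightarrow> (('m, 'n) dom \<Rightarrow> real) set"
  where "orth_polys n \<Omega> W = {u.
     (u = (\<lambda>z. 0) \<or> (real_polynomial_function u \<and> total_degree u = n)) \<and>
     (\<forall>q. real_polynomial_function q \<and> total_degree q < n \<longrightarrow>
        (LINT z:\<Omega>|lborel. u z * q z * W z) = 0)}"

definition simplex_set :: "(real ^ 'n::finite) set" where
  "simplex_set = {y. (\<forall>j. 0 \<le> y $ j) \<and> entry_sum y \<le> 1}"

definition LT_domain :: "('m::finite, 'n::finite) dom set" where
  "LT_domain = {x. \<forall>i. 0 \<le> x $ i} \<times> simplex_set"

text \<open>The parameter \<open>\<kappa>\<close> has \<open>d\<^sub>2 + 1\<close> entries and is indexed by \<^typ>\<open>'n option\<close>: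
  \<open>\<kappa> $ Some j\<close> belongs to \<open>y\<^sub>j\<close>, and \<open>\<kappa> $ None\<close> is the last entry, belonging to
  \<open>1 - |y|\<close>. On the null set where \<open>|y| = 1\<close> the quotient in the exponent is 0.\<close>

definition LT_weight ::
    "real ^ 'm::finite \<Rightarrow> real ^ ('n::finite option) \<Rightarrow> ('m, 'n) dom \<Rightarrow> real" where
  "LT_weight \<gamma> \<kappa> = (\<lambda>(x, y).
     (\<Prod>j\<in>UNIV. (y $ j) powr (\<kappa> $ Some j)) * (1 - entry_sum y) powr (\<kappa> $ None) *
     (\<Prod>i\<in>UNIV. (x $ i) powr (\<gamma> $ i)) * exp (- (entry_sum x / (1 - entry_sum y))))"

definition pdx :: "'m::finite \<Rightarrow> (('m, 'n::finite) dom \<Rightarrow> real) \<Rightarrow> ('m, 'n) dom \<Rightarrow> real" where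
  "pdx i f = (\<lambda>(x, y). deriv (\<lambda>t. f (x + t *\<^sub>R axis i 1, y)) 0)"

definition pdy :: "'n::finite \<Rightarrow> (('m::finite, 'n) dom \<Rightarrow> real) \<Rightarrow> ('m, 'n) dom \<Rightarrow> real" where
  "pdy j f = (\<lambda>(x, y). deriv (\<lambda>t. f (x, y + t *\<^sub>R axis j 1)) 0)"

definition eulerx :: "(('m::finite, 'n::finite) dom \<Rightarrow> real) \<Rightarrow> ('m, 'n) dom \<Rightarrow> real" where
  "eulerx f = (\<lambda>(x, y). \<Sum>i\<in>UNIV. x $ i * pdx i f (x, y))"

definition eulery :: "(('m::finite, 'n::finite) dom \<Rightarrow> real) \<Rightarrow> ('m, 'n) dom \<Rightarrow> real" where
  "eulery f = (\<lambda>(x, y). \<Sum>j\<in>UNIV. y $ j * pdy j f (x, y))"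

definition euler :: "(('m::finite, 'n::finite) dom \<Rightarrow> real) \<Rightarrow> ('m, 'n) dom \<Rightarrow> real" where
  "euler f = (\<lambda>z. eulerx f z + eulery f z)"

definition Lx ::
    "real ^ 'm::finite \<Rightarrow> (('m, 'n::finite) dom \<Rightarrow> real) \<Rightarrow> ('m, 'n) dom \<Rightarrow> real" where
  "Lx \<gamma> f = (\<lambda>(x, y). \<Sum>i\<in>UNIV.
     x $ i * pdx i (pdx i f) (x, y) + (\<gamma> $ i + 1) * pdx i f (x, y))"

definition Ly ::
    "real ^ ('n::finite option) \<Rightarrow> (('m::finite, 'n) dom \<Rightarrow> real) \<Rightarrow> ('m, 'n) dom \<Rightarrow> real" where
  "Ly \<kappa> f = (\<lambda>(x, y). \<Sum>j\<in>UNIV.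
     y $ j * pdy j (pdy j f) (x, y) + (\<kappa> $ Some j + 1) * pdy j f (x, y))"

definition LT_operator ::
    "real ^ 'm::finite \<Rightarrow> real ^ ('n::finite option) \<Rightarrow> (('m, 'n) dom \<Rightarrow> real) \<Rightarrow> ('m, 'n) dom \<Rightarrow> real"
  where "LT_operator \<gamma> \<kappa> f = (\<lambda>(x, y).
     - (1 - entry_sum y) * Lx \<gamma> (Lx \<gamma> f) (x, y)
     + Lx \<gamma> (eulerx f) (x, y) + eulerx (Lx \<gamma> f) (x, y)
     + (\<kappa> $ None + entry_sum \<gamma> + real CARD('m)) * Lx \<gamma> f (x, y)
     + Ly \<kappa> f (x, y)
     - euler (euler f) (x, y)
     - (entry_sum \<kappa> + entry_sum \<gamma> + real CARD('m) + real CARD('n)) * euler f (x, y))"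

text \<open>The index sets below are finite, and every polynomial function lies in some
  \<^term>\<open>polys_le N\<close>, so \<^const>\<open>total_degree\<close> is meaningful for all of them.\<close>

lemma finite_multi_indices_le:
  "finite (multi_indices_le N :: (('m::finite \<Rightarrow> nat) \<times> ('n::finite \<Rightarrow> nat)) set)"
proof (rule finite_subset)
  show "(multi_indices_le N :: (('m \<Rightarrow> nat) \<times> ('n \<Rightarrow> nat)) set)
      \<subseteq> (UNIV \<rightarrow>\<^sub>E {..N}) \<times> (UNIV \<rightarrow>\<^sub>E {..N})"
  proof
    fix a :: "('m \<Rightarrow> nat) \<times> ('n \<Rightarrow> nat)"
    assume "a \<in> multi_indices_le N"
    then have le: "sum (fst a) UNIV + sum (snd a) UNIV \<le> N"
      by (auto simp: multi_indices_le_def)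
    have "fst a i \<le> N" for i using member_le_sum[of i UNIV "fst a"] le by simp
    moreover have "snd a j \<le> N" for j using member_le_sum[of j UNIV "snd a"] le by simp
    ultimately show "a \<in> (UNIV \<rightarrow>\<^sub>E {..N}) \<times> (UNIV \<rightarrow>\<^sub>E {..N})"
      by (auto simp: mem_Times_iff)
  qed
qed (auto intro!: finite_PiE)

lemma polys_le_mono:
  assumes "f \<in> polys_le M" "M \<le> N"
  shows "f \<in> polys_le N"
proof -
  obtain c where f: "f = (\<lambda>z. \<Sum>a\<in>multi_indices_le M. c a * monomial_fun a z)"
    using assms by (auto simp: polys_le_def)
  have "f = (\<lambda>z. \<Sum>a\<in>multi_indices_le N.
      (if a \<in> multi_indices_le M then c a else 0) * monomial_fun a z)"
    unfolding f
    by (intro ext sum.mono_neutral_cong_left finite_multi_indices_le)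
       (use assms in \<open>auto simp: multi_indices_le_def\<close>)
  then show ?thesis by (auto simp: polys_le_def)
qed

lemma polys_le_add: "f \<in> polys_le N \<Longrightarrow> g \<in> polys_le N \<Longrightarrow> (\<lambda>z. f z + g z) \<in> polys_le N"
proof -
  assume "f \<in> polys_le N" "g \<in> polys_le N"
  then obtain c d where "f = (\<lambda>z. \<Sum>a\<in>multi_indices_le N. c a * monomial_fun a z)"
    "g = (\<lambda>z. \<Sum>a\<in>multi_indices_le N. d a * monomial_fun a z)" by (auto simp: polys_le_def)
  then show ?thesis unfolding polys_le_def
    by (intro CollectI exI[of _ "\<lambda>a. c a + d a"]) (simp add: sum.distrib distrib_right)
qed

lemma polys_le_cmult: "f \<in> polys_le N \<Longrightarrow> (\<lambda>z. r * f z) \<in> polys_le N"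
proof -
  assume "f \<in> polys_le N"
  then obtain c where "f = (\<lambda>z. \<Sum>a\<in>multi_indices_le N. c a * monomial_fun a z)"
    by (auto simp: polys_le_def)
  then show ?thesis unfolding polys_le_def
    by (intro CollectI exI[of _ "\<lambda>a. r * c a"]) (simp add: sum_distrib_left mult.assoc)
qed

lemma polys_le_zero: "(\<lambda>z. 0) \<in> polys_le N"
  by (auto simp: polys_le_def intro!: exI[of _ "\<lambda>_. 0"])

lemma polys_le_sum:
  "(\<And>a. a \<in> S \<Longrightarrow> f a \<in> polys_le N) \<Longrightarrow> (\<lambda>z. \<Sum>a\<in>S. f a z) \<in> polys_le N"
  by (induction S rule: infinite_finite_induct) (auto intro: polys_le_zero polys_le_add)

lemma polys_le_monomial: "a \<in> multi_indices_le N \<Longrightarrow> monomial_fun a \<in> polys_le N"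
  by (auto simp: polys_le_def finite_multi_indices_le if_distrib[of "\<lambda>x. x * _"] sum.delta
      intro!: exI[of _ "\<lambda>b. if b = a then 1 else 0"] cong: if_cong)

lemma polys_le_mult:
  assumes "f \<in> polys_le M" "g \<in> polys_le N"
  shows "(\<lambda>z. f z * g z) \<in> polys_le (M + N)"
proof -
  obtain c d where fg: "f = (\<lambda>z. \<Sum>a\<in>multi_indices_le M. c a * monomial_fun a z)"
    "g = (\<lambda>z. \<Sum>a\<in>multi_indices_le N. d a * monomial_fun a z)"
    using assms by (auto simp: polys_le_def)
  have "(\<lambda>z. monomial_fun a z * monomial_fun b z) \<in> polys_le (M + N)"
    if ab: "a \<in> multi_indices_le M" "b \<in> multi_indices_le N"
    for a b :: "('a \<Rightarrow> nat) \<times> ('b \<Rightarrow> nat)"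
  proof -
    obtain a1 a2 b1 b2 where p: "a = (a1, a2)" "b = (b1, b2)" by (meson surj_pair)
    have "(\<lambda>z. monomial_fun a z * monomial_fun b z) =
        monomial_fun (\<lambda>i. a1 i + b1 i, \<lambda>i. a2 i + b2 i)"
      by (auto simp: monomial_fun_def p power_add prod.distrib)
    moreover have "(\<lambda>i. a1 i + b1 i, \<lambda>i. a2 i + b2 i) \<in> multi_indices_le (M + N)"
      using ab by (auto simp: multi_indices_le_def p sum.distrib)
    ultimately show ?thesis by (simp add: polys_le_monomial)
  qed
  then have "(\<lambda>z. c a * d b * (monomial_fun a z * monomial_fun b z)) \<in> polys_le (M + N)"
    if "a \<in> multi_indices_le M" "b \<in> multi_indices_le N" for a b
    using that polys_le_cmult by blast
  then have "(\<lambda>z. \<Sum>a\<in>multi_indices_le M. \<Sum>b\<in>multi_indices_le N.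
      c a * d b * (monomial_fun a z * monomial_fun b z)) \<in> polys_le (M + N)"
    by (intro polys_le_sum)
  then show ?thesis by (simp add: fg sum_product algebra_simps)
qed

lemma polys_le_fst: "(\<lambda>z :: ('m::finite, 'n::finite) dom. fst z $ i) \<in> polys_le 1"
proof -
  have "(\<lambda>z :: ('m, 'n) dom. fst z $ i) = monomial_fun ((\<lambda>k. if k = i then 1 else 0), (\<lambda>_. 0))"
    by (auto simp: monomial_fun_def if_distrib[of "power _"] prod.delta cong: if_cong)
  then show ?thesis by (simp add: polys_le_monomial multi_indices_le_def sum.delta)
qed

lemma polys_le_snd: "(\<lambda>z :: ('m::finite, 'n::finite) dom. snd z $ j) \<in> polys_le 1"
proof -
  have "(\<lambda>z :: ('m, 'n) dom. snd z $ j) = monomial_fun ((\<lambda>_. 0), (\<lambda>k. if k = j then 1 else 0))"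
    by (auto simp: monomial_fun_def if_distrib[of "power _"] prod.delta cong: if_cong)
  then show ?thesis by (simp add: polys_le_monomial multi_indices_le_def sum.delta)
qed

lemma polys_le_const: "(\<lambda>z :: ('m::finite, 'n::finite) dom. c) \<in> polys_le 0"
proof -
  have "(\<lambda>z :: ('m, 'n) dom. 1) = monomial_fun ((\<lambda>_. 0), (\<lambda>_. 0))" by (auto simp: monomial_fun_def)
  then have "(\<lambda>z :: ('m, 'n) dom. 1) \<in> polys_le 0" by (simp add: polys_le_monomial multi_indices_le_def)
  from polys_le_cmult[OF this, of c] show ?thesis by simp
qed

lemma polys_le_linear:
  assumes "bounded_linear f"
  shows "f \<in> polys_le 1"
proof -
  interpret bounded_linear f by fact
  have eq: "f z = (\<Sum>i\<in>UNIV. f (axis i 1, 0) * fst z $ i) + (\<Sum>j\<in>UNIV. f (0, axis j 1) * snd z $ j)"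
    for z
  proof -
    have "z = (\<Sum>i\<in>UNIV. fst z $ i *\<^sub>R (axis i 1, 0)) + (\<Sum>j\<in>UNIV. snd z $ j *\<^sub>R (0, axis j 1))"
      using basis_expansion[of "fst z"] basis_expansion[of "snd z"]
      by (simp add: prod_eq_iff fst_sum snd_sum scalar_mult_eq_scaleR)
    then have "f z = f (\<dots>)" by (rule arg_cong)
    also have "\<dots> = (\<Sum>i\<in>UNIV. fst z $ i * f (axis i 1, 0)) + (\<Sum>j\<in>UNIV. snd z $ j * f (0, axis j 1))"
      by (simp add: add sum scaleR del: scaleR_Pair)
    finally show ?thesis by (simp add: mult.commute)
  qed
  have "(\<lambda>z. (\<Sum>i\<in>UNIV. f (axis i 1, 0) * fst z $ i) + (\<Sum>j\<in>UNIV. f (0, axis j 1) * snd z $ j))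
      \<in> polys_le 1"
    by (intro polys_le_add polys_le_sum polys_le_cmult polys_le_fst polys_le_snd)
  then show ?thesis unfolding eq[symmetric] .
qed

lemma real_polynomial_function_iff_polys_le:
  "real_polynomial_function f \<longleftrightarrow> (\<exists>N. f \<in> polys_le N)"
proof
  assume "real_polynomial_function f"
  then show "\<exists>N. f \<in> polys_le N"
  proof induction
    case (linear f) then show ?case using polys_le_linear by blast
  next
    case (const c) then show ?case using polys_le_const by blast
  next
    case (add f g)
    then obtain M N where "f \<in> polys_le M" "g \<in> polys_le N" by blast
    then have "f \<in> polys_le (max M N)" "g \<in> polys_le (max M N)"
      using polys_le_mono by (meson max.cobounded1 max.cobounded2)+
    then show ?case using polys_le_add by blast
  next
    case (mult f g) then show ?case using polys_le_mult by blast
  qed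
next
  assume "\<exists>N. f \<in> polys_le N"
  then obtain N c where f: "f = (\<lambda>z. \<Sum>a\<in>multi_indices_le N. c a * monomial_fun a z)"
    by (auto simp: polys_le_def)
  have lin: "real_polynomial_function (\<lambda>z :: ('a, 'b) dom. fst z $ i)"
    "real_polynomial_function (\<lambda>z :: ('a, 'b) dom. snd z $ j)" for i j
    by (auto intro!: real_polynomial_function.intros(1)
        bounded_linear_compose[OF bounded_linear_vec_nth bounded_linear_fst]
        bounded_linear_compose[OF bounded_linear_vec_nth bounded_linear_snd])
  have "real_polynomial_function (monomial_fun a)" for a :: "('a \<Rightarrow> nat) \<times> ('b \<Rightarrow> nat)"
  proof -
    have "monomial_fun a = (\<lambda>z. (\<Prod>i\<in>UNIV. (fst z $ i) ^ fst a i) * (\<Prod>j\<in>UNIV. (snd z $ j) ^ snd a j))"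
      by (auto simp: monomial_fun_def split: prod.splits)
    then show ?thesis
      by (auto intro!: real_polynomial_function.intros(4) real_polynomial_function_prod
          real_polynomial_function_power lin)
  qed
  then show "real_polynomial_function f" unfolding f
    by (intro real_polynomial_function_sum finite_multi_indices_le
        real_polynomial_function.intros(4) real_polynomial_function.intros(2))
qed

end

theory Submission
  imports Defs
begin

text \<open>
  Write $s = 1 - |y|$, $E$ for the Euler operator in $x$, $L$ for the Laguerre operator
  \<open>Lx \<gamma>\<close>, $D$ for \<open>LT_operator \<gamma> \<kappa>\<close>, and $I(f)$ for the integral of $f$ against the weight. With
  $l = |\kappa| + |\gamma| + d_1 + d_2 > -1$ the eigenvalues are $-n(n + l)$, and they are pairwise
  distinct. The theorem follows from two properties of $D$ on polynomials.

  \<^item> $D$ is triangular: on polynomials of degree at most $N$ it is multiplication by $-N(N+l)$ up to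
    terms of degree less than $N$ (\<open>LT_operator_triangular\<close>).
  \<^item> $D$ is symmetric: $I(Df \cdot g) = I(f \cdot Dg)$ (\<open>LT_operator_symmetric\<close>).

  If $u$ has degree $n$ and is orthogonal to all lower degrees, then $w = Du + n(n+l)u$ has degree
  less than $n$, and by symmetry and triangularity it is orthogonal to all polynomials of degree
  less than $n$, itself included; as the weight is positive, $w = 0$. Conversely, a polynomial
  eigenfunction with eigenvalue $-n(n+l)$ has degree $n$ by triangularity, because the diagonal
  entries differ; and every $q$ of degree less than $n$ has the form $Dr + n(n+l)r$ with a
  polynomial $r$, so $I(uq) = I((Du + n(n+l)u)r) = 0$.

  Triangularity is read off from the action on monomials. Symmetry needs information about $I$, and
  the moments supply it. A monomial times the weight is the weight with larger parameters, so one
  evaluation of the total mass (\<open>nn_integral_LT_weight\<close>) gives every moment as a quotient of Gamma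
  values, and $\Gamma(t+1) = t\,\Gamma(t)$ gives relations between neighbouring moments
  (\<open>moment_x_slack\<close>, \<open>moment_x\<close>, \<open>moment_y\<close>). These relations replace integration by parts.

  The term of order four is handled by a factorisation. On a fibre $y = const$ the operator
  $sL - E$ is the Laguerre operator belonging to $x^\gamma e^{-|x|/s}$, so it is symmetric there and
  hence on the whole domain (\<open>slack_Lx_symmetric\<close>). Using this once with $Lf$ in place of $f$
  turns $I(s\,L^2f \cdot g)$ into the symmetric expression $I(s\,Lf\cdot Lg)$ plus a multiple of
  $I(Lf\cdot g)$ for monomials. What remains is, up to a factor, the antisymmetric part of
  $I(Lf\cdot g)$ and of $I(L^{(y)}f\cdot g)$. For monomials $f, g$ of degrees $p, q$ these are
  $(p+q+l)\,I(fg)$ times the difference of the $x$-degrees and of the $y$-degrees;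
  together they give $(p-q)(p+q+l)\,I(fg)$, which is cancelled
      by the difference of $p(p+l)$ and $q(q+l)$.
\<close>

section \<open>Gamma and Dirichlet integrals\<close>

lemma nn_integral_lborel_vec_prod:
  fixes f :: "'k::finite \<Rightarrow> real \<Rightarrow> ennreal"
  assumes [measurable]: "\<And>i. f i \<in> borel_measurable borel"
  shows "(\<integral>\<^sup>+x. (\<Prod>i\<in>UNIV. f i (x $ i)) \<partial>(lborel :: (real ^ 'k) measure))
      = (\<Prod>i\<in>UNIV. \<integral>\<^sup>+t. f i t \<partial>lborel)"
proof -
  define F where "F b = f (SOME i. b = axis i (1::real))" for b :: "real ^ 'k"
  have F: "F (axis i 1) = f i" for i
    by (simp add: F_def axis_eq_axis)
  have B: "(Basis :: (real ^ 'k) set) = (\<lambda>i. axis i 1) ` UNIV"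
    by (auto simp: Basis_vec_def)
  have inj: "inj_on (\<lambda>i. axis i (1::real) :: real ^ 'k) UNIV"
    by (auto simp: inj_on_def axis_eq_axis)
  have "(\<integral>\<^sup>+x. (\<Prod>b\<in>Basis. F b (x \<bullet> b)) \<partial>lborel) = (\<Prod>b\<in>Basis. (\<integral>\<^sup>+t. F b t \<partial>lborel))"
    by (rule nn_integral_lborel_prod) (auto simp: F_def)
  then show ?thesis
    unfolding B by (simp add: prod.reindex[OF inj] F inner_axis)
qed

lemma nn_integral_Gamma_scaled:
  assumes "g > -1" "s > (0::real)"
  shows "(\<integral>\<^sup>+t. ennreal (indicator {0..} t * (t powr g * exp (- (t / s)))) \<partial>lborel)
      = ennreal (Gamma (g + 1) * s powr (g + 1))"
proof -
  have "(\<integral>\<^sup>+t. ennreal (indicator {0..} t * (t powr g * exp (- (t / s)))) \<partial>lborel)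
      = ennreal s * (\<integral>\<^sup>+t. ennreal (indicator {0..} (s * t)
          * ((s * t) powr g * exp (- (s * t / s)))) \<partial>lborel)"
    using assms by (subst nn_integral_real_affine[where t = 0 and c = s]) auto
  also have "(\<integral>\<^sup>+t. ennreal (indicator {0..} (s * t) * ((s * t) powr g * exp (- (s * t / s))))
      \<partial>lborel)
      = (\<integral>\<^sup>+t. ennreal (s powr g) * ennreal (indicator {0..} t * t powr (g + 1 - 1) / exp t)
          \<partial>lborel)"
    using assms
    by (intro nn_integral_cong) (auto simp: indicator_def powr_mult exp_minus field_simps
        zero_le_mult_iff simp flip: ennreal_mult)
  also have "\<dots> = ennreal (s powr g) * ennreal (Gamma (g + 1))"
    using assms by (subst nn_integral_cmult) (auto simp: Gamma_conv_nn_integral_real)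
  also have "ennreal s * \<dots> = ennreal (Gamma (g + 1) * s powr (g + 1))"
    using assms by (simp add: powr_add Gamma_real_pos less_imp_le mult_ac flip: ennreal_mult)
  finally show ?thesis .
qed

definition orthant :: "(real ^ 'k::finite) set" where "orthant = {x. \<forall>i. 0 \<le> x $ i}"

lemma orthant_sets [measurable]: "(orthant :: (real ^ 'k::finite) set) \<in> sets borel"
proof -
  have "closed (orthant :: (real ^ 'k) set)"
    unfolding orthant_def by (intro closed_Collect_all closed_Collect_le continuous_intros)
  then show ?thesis by simp
qed

lemma measurable_entry_sum [measurable]: "entry_sum \<in> borel_measurable borel"
  unfolding entry_sum_def by measurable

lemma nn_integral_Gamma_vec:
  fixes g :: "real ^ 'k::finite"
  assumes "\<forall>i. g $ i > -1" "s > 0"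
  shows "(\<integral>\<^sup>+x. ennreal (indicator orthant x *
      ((\<Prod>i\<in>UNIV. (x $ i) powr (g $ i)) * exp (- (entry_sum x / s)))) \<partial>lborel)
    = ennreal ((\<Prod>i\<in>UNIV. Gamma (g $ i + 1)) * s powr (entry_sum g + real CARD('k)))"
proof -
  let ?f = "\<lambda>i t. ennreal (indicator {0..} t * (t powr (g $ i) * exp (- (t / s))))"
  have "ennreal (indicator orthant x * ((\<Prod>i\<in>UNIV. (x $ i) powr (g $ i))
      * exp (- (entry_sum x / s))))
     = (\<Prod>i\<in>UNIV. ?f i (x $ i))" for x :: "real ^ 'k"
  proof -
    have "(\<Prod>i\<in>UNIV. ?f i (x $ i)) = ennreal (\<Prod>i\<in>UNIV. indicator {0..} (x $ i)
        * ((x $ i) powr (g $ i) * exp (- (x $ i / s))))"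
      by (intro prod_ennreal) auto
    also have "(\<Prod>i\<in>UNIV. indicator {0..} (x $ i) * ((x $ i) powr (g $ i) * exp (- (x $ i / s))))
      = (\<Prod>i\<in>UNIV. indicator {0..} (x $ i)) * ((\<Prod>i\<in>UNIV. (x $ i) powr (g $ i))
          * exp (- (entry_sum x / s)))"
      by (simp add: prod.distrib entry_sum_def exp_sum sum_divide_distrib flip: sum_negf)
    also have "(\<Prod>i\<in>UNIV. indicator {0..} (x $ i)) = (indicator orthant x :: real)"
      by (auto simp: indicator_def orthant_def prod_zero_iff)
    finally show ?thesis by simp
  qed
  then have "(\<integral>\<^sup>+x. ennreal (indicator orthant x
      * ((\<Prod>i\<in>UNIV. (x $ i) powr (g $ i)) * exp (- (entry_sum x / s)))) \<partial>lborel)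
     = (\<Prod>i\<in>UNIV. \<integral>\<^sup>+t. ?f i t \<partial>lborel)"
    by (simp only:) (rule nn_integral_lborel_vec_prod, measurable)
  also have "\<dots> = (\<Prod>i\<in>UNIV. ennreal (Gamma (g $ i + 1) * s powr (g $ i + 1)))"
    using assms by (simp add: nn_integral_Gamma_scaled)
  also have "\<dots> = ennreal (\<Prod>i\<in>UNIV. Gamma (g $ i + 1) * s powr (g $ i + 1))"
  proof (intro prod_ennreal)
    fix i have "g $ i + 1 > 0" using assms(1)[rule_format, of i] by simp
    from Gamma_real_pos[OF this] show "0 \<le> Gamma (g $ i + 1) * s powr (g $ i + 1)" by simp
  qed
  also have "(\<Prod>i\<in>UNIV. Gamma (g $ i + 1) * s powr (g $ i + 1))
      = (\<Prod>i\<in>UNIV. Gamma (g $ i + 1)) * s powr (entry_sum g + real CARD('k))"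
    using assms by (simp add: prod.distrib powr_sum[symmetric] sum.distrib entry_sum_def)
  finally show ?thesis .
qed

lemma nn_integral_lborel_scale:
  fixes f :: "'a::euclidean_space \<Rightarrow> ennreal"
  assumes [measurable]: "f \<in> borel_measurable borel" and c: "c > 0"
  shows "(\<integral>\<^sup>+x. f x \<partial>lborel) = ennreal (c ^ DIM('a)) * (\<integral>\<^sup>+x. f (c *\<^sub>R x) \<partial>lborel)"
  using c by (subst lborel_affine[of c 0])
     (auto simp add: nn_integral_density nn_integral_distr nn_integral_cmult ennreal_power)

text \<open>Tonelli's theorem turns this integral into Gamma integrals by a Laplace transform in an
  auxiliary variable $t$. Let $F(t)$ be the integral of $\prod_i y_i^{k_i}\,(t-|y|)^A$ over
  $y_i \ge 0$, $|y|\le t$; by scaling, $F(t)$ is a power of $t$ times $F(1)$. Integrating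
  $e^{-t}F(t)$ over $t$ therefore yields $F(1)$ times a Gamma value, whereas integrating over $t$
  first yields $\Gamma(A+1)$ times the product of the one-dimensional integrals.\<close>
lemma nn_integral_Dirichlet:
  fixes k :: "real ^ 'k::finite" and A :: real
  assumes k: "\<forall>i. k $ i > -1" and A: "A > -1"
  shows "(\<integral>\<^sup>+y. ennreal (indicator simplex_set y
      * ((\<Prod>i\<in>UNIV. (y $ i) powr (k $ i)) * (1 - entry_sum y) powr A)) \<partial>lborel)
    = ennreal ((\<Prod>i\<in>UNIV. Gamma (k $ i + 1)) * Gamma (A + 1) / Gamma
        (entry_sum k + real CARD('k) + A + 1))"
proof -
  define p where "p y = (\<Prod>i\<in>UNIV. (y $ i) powr (k $ i))" for y :: "real ^ 'k"
  have [measurable]: "p \<in> borel_measurable borel" unfolding p_def by measurable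
  have p0: "p y \<ge> 0" for y by (auto simp: p_def intro: prod_nonneg)
  let ?e = "entry_sum :: real ^ 'k \<Rightarrow> real"
  let ?d = "real CARD('k)"
  define \<phi> where "\<phi> t y = ennreal (indicator orthant y * indicator {..t} (?e y)
      * (p y * (t - ?e y) powr A))"
    for t and y :: "real ^ 'k"
  have [measurable]: "case_prod \<phi> \<in> borel_measurable (borel \<Otimes>\<^sub>M borel)"
  proof -
    have *: "indicator {..t} (?e y) = (if ?e y \<le> t then 1 else 0 :: real)" for t y
        by (auto simp: indicator_def)
    show ?thesis unfolding \<phi>_def[abs_def] * by measurable
  qed
  define G where "G = (\<integral>\<^sup>+y. \<phi> 1 y \<partial>lborel)"
  have Gk: "Gamma (k $ i + 1) > 0" for i using k[rule_format, of i]
      by (intro Gamma_real_pos) linarith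
  have sk: "entry_sum k + ?d \<ge> 0"
  proof -
    have "entry_sum k + ?d = (\<Sum>i\<in>UNIV. k $ i + 1)" by (simp add: entry_sum_def sum.distrib)
    also have "\<dots> \<ge> 0"
    proof (rule sum_nonneg)
      fix i show "0 \<le> k $ i + 1" using k[rule_format, of i] by simp
    qed
    finally show ?thesis .
  qed
  let ?R = "Gamma (entry_sum k + ?d + A + 1)"
  have R: "?R > 0" using sk A by (intro Gamma_real_pos) linarith
  have lhs: "(\<integral>\<^sup>+y. ennreal (indicator simplex_set y
      * ((\<Prod>i\<in>UNIV. (y $ i) powr (k $ i)) * (1 - entry_sum y) powr A)) \<partial>lborel) = G"
    unfolding G_def \<phi>_def p_def simplex_set_def orthant_def
        by (intro nn_integral_cong) (auto simp: indicator_def)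
  (* d powers of t come from the change of variables, the others from the integrand *)
  have scale: "(\<integral>\<^sup>+y. \<phi> t y \<partial>lborel) = ennreal (t powr (entry_sum k + ?d + A)) * G" if t: "t > 0"
      for t
  proof -
    have es: "?e (t *\<^sub>R y) = t * ?e y" for y by (simp add: entry_sum_def sum_distrib_left)
    have "(\<integral>\<^sup>+y. \<phi> t y \<partial>lborel) = ennreal (t ^ DIM(real ^ 'k)) * (\<integral>\<^sup>+y. \<phi> t (t *\<^sub>R y) \<partial>lborel)"
      using t by (intro nn_integral_lborel_scale) measurable
    also have "(\<integral>\<^sup>+y. \<phi> t (t *\<^sub>R y) \<partial>lborel) =
        (\<integral>\<^sup>+y. ennreal (t powr (entry_sum k + A)) * \<phi> 1 y \<partial>lborel)"
    proof (intro nn_integral_cong)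
      fix y :: "real ^ 'k"
      have o: "t *\<^sub>R y \<in> orthant \<longleftrightarrow> y \<in> orthant" "t * ?e y \<le> t \<longleftrightarrow> ?e y \<le> 1"
        using t by (auto simp: orthant_def zero_le_mult_iff mult_le_cancel_left2)
      show "\<phi> t (t *\<^sub>R y) = ennreal (t powr (entry_sum k + A)) * \<phi> 1 y"
      proof (cases "y \<in> orthant \<and> ?e y \<le> 1")
        case True
        have "p (t *\<^sub>R y) = t powr entry_sum k * p y"
          using t True by (simp add: p_def powr_mult prod.distrib entry_sum_def powr_sum
              orthant_def)
        moreover have "(t - t * ?e y) powr A = t powr A * (1 - ?e y) powr A"
          using t True by (simp add: powr_mult[symmetric] algebra_simps)
        ultimately show ?thesis using True o p0
          by (simp add: \<phi>_def es powr_add mult_ac flip: ennreal_mult)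
      qed (use o in \<open>auto simp: \<phi>_def es indicator_def\<close>)
    qed
    also have "\<dots> = ennreal (t powr (entry_sum k + A)) * G"
      unfolding G_def by (intro nn_integral_cmult) measurable
    also have "ennreal (t ^ DIM(real ^ 'k)) * \<dots> = ennreal (t powr (entry_sum k + ?d + A)) * G"
      using t by (simp add: powr_add powr_realpow ac_simps ennreal_mult)
    finally show ?thesis .
  qed
  have "ennreal ?R * G = (\<integral>\<^sup>+t. ennreal (indicator {0..} t
      * t powr (entry_sum k + ?d + A + 1 - 1) / exp t) * G \<partial>lborel)"
    using R sk A by (subst nn_integral_multc) (auto simp: Gamma_conv_nn_integral_real)
  also have "\<dots> = (\<integral>\<^sup>+t. ennreal (exp (- t)) * (\<integral>\<^sup>+y. \<phi> t y \<partial>lborel) \<partial>lborel)"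
  proof (rule nn_integral_cong_AE)
    show "AE t in lborel. ennreal (indicator {0..} t
        * t powr (entry_sum k + ?d + A + 1 - 1) / exp t) * G
        = ennreal (exp (- t)) * (\<integral>\<^sup>+y. \<phi> t y \<partial>lborel)"
      using AE_lborel_singleton[of "0::real"]
    proof eventually_elim
      case (elim t)
      show ?case
      proof (cases "t > 0")
        case True
        have "ennreal (indicator {0..} t * t powr (entry_sum k + ?d + A + 1 - 1) / exp t)
            = ennreal (exp (- t)) * ennreal (t powr (entry_sum k + ?d + A))"
          using True by (simp add: exp_minus field_simps flip: ennreal_mult)
        then show ?thesis using True by (simp add: scale mult.assoc)
      next
        (* for t < 0 the domain of integration is empty *)
        case False
        then have t: "t < 0" using elim by auto
        have "?e y \<ge> 0" if "y \<in> orthant" for y :: "real ^ 'k"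
          using that by (auto simp: orthant_def entry_sum_def intro: sum_nonneg)
        then have "\<phi> t y = 0" for y
          using t by (force simp: \<phi>_def indicator_def)
        then show ?thesis using t by simp
      qed
    qed
  qed
  also have "\<dots> = (\<integral>\<^sup>+t. \<integral>\<^sup>+y. ennreal (exp (- t)) * \<phi> t y \<partial>lborel \<partial>lborel)"
    by (intro nn_integral_cong nn_integral_cmult[symmetric]) measurable
  also have "\<dots> = (\<integral>\<^sup>+y. \<integral>\<^sup>+t. ennreal (exp (- t)) * \<phi> t y \<partial>lborel \<partial>lborel)"
    by (rule lborel_pair.Fubini') measurable
  also have "\<dots> = (\<integral>\<^sup>+y. ennreal (Gamma (A + 1))
      * ennreal (indicator orthant y * ((\<Prod>i\<in>UNIV. (y $ i) powr (k $ i))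
          * exp (- (entry_sum y / 1)))) \<partial>lborel)"
  proof (intro nn_integral_cong)
    fix y :: "real ^ 'k"
    have "(\<integral>\<^sup>+t. ennreal (exp (- t)) * \<phi> t y \<partial>lborel)
        = (\<integral>\<^sup>+t. ennreal (exp (- (?e y + t))) * \<phi> (?e y + t) y \<partial>lborel)"
      by (subst nn_integral_real_affine[where t = "?e y" and c = 1]) auto
    also have "\<dots> = (\<integral>\<^sup>+t. ennreal (indicator orthant y * (p y * exp (- ?e y)))
        * ennreal (indicator {0..} t * t powr (A + 1 - 1) / exp t) \<partial>lborel)"
      by (intro nn_integral_cong)
        (auto simp: \<phi>_def indicator_def p0 exp_minus exp_add exp_diff field_simps simp flip:
            ennreal_mult)
    also have "\<dots> = ennreal (indicator orthant y * (p y * exp (- ?e y))) * ennreal (Gamma (A + 1))"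
      using A by (subst nn_integral_cmult) (auto simp: Gamma_conv_nn_integral_real)
    finally show "(\<integral>\<^sup>+t. ennreal (exp (- t)) * \<phi> t y \<partial>lborel)
        = ennreal (Gamma (A + 1)) * ennreal (indicator orthant y
            * ((\<Prod>i\<in>UNIV. (y $ i) powr (k $ i)) * exp (- (entry_sum y / 1))))"
      by (simp add: p_def mult.commute)
  qed
  also have "\<dots> = ennreal (Gamma (A + 1)) * ennreal (\<Prod>i\<in>UNIV. Gamma (k $ i + 1))"
    using k by (subst nn_integral_cmult, measurable)
       (use nn_integral_Gamma_vec[of k 1] in simp_all)
  also have "\<dots> = ennreal (Gamma (A + 1) * (\<Prod>i\<in>UNIV. Gamma (k $ i + 1)))"
    using Gk A by (simp add: ennreal_mult Gamma_real_pos less_imp_le prod_nonneg)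
  finally have eq: "ennreal ?R * G = ennreal (Gamma (A + 1) * (\<Prod>i\<in>UNIV. Gamma (k $ i + 1)))" .
  have "G = ennreal (1 / ?R) * (ennreal ?R * G)"
    using R by (simp flip: ennreal_mult mult.assoc)
  also have "\<dots> = ennreal ((\<Prod>i\<in>UNIV. Gamma (k $ i + 1)) * Gamma (A + 1) / ?R)"
    unfolding eq using R Gk A by (simp add: Gamma_real_pos less_imp_le prod_nonneg mult.commute
        flip: ennreal_mult)
  finally show ?thesis unfolding lhs .
qed

section \<open>The total mass of the weight\<close>

definition LT_moment :: "real ^ 'm::finite \<Rightarrow> real ^ ('n::finite option) \<Rightarrow> real" where
  "LT_moment \<gamma> \<kappa> = (\<Prod>i\<in>UNIV. Gamma (\<gamma> $ i + 1)) * (\<Prod>j\<in>UNIV. Gamma (\<kappa> $ Some j + 1)) *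
     Gamma (\<kappa> $ None + entry_sum \<gamma> + real CARD('m) + 1) /
     Gamma (entry_sum \<kappa> + entry_sum \<gamma> + real CARD('m) + real CARD('n) + 1)"

lemma entry_sum_option: "entry_sum (\<kappa> :: real ^ ('n::finite option))
    = \<kappa> $ None + (\<Sum>j\<in>UNIV. \<kappa> $ Some j)"
  by (simp add: entry_sum_def UNIV_option_conv sum.reindex)

lemma entry_sum_add_card_pos:
  assumes "\<forall>i. g $ i > -1"
  shows "entry_sum (g :: real ^ 'k::finite) + real CARD('k) > 0"
proof -
  have "0 < (\<Sum>i\<in>UNIV. g $ i + 1)"
  proof (rule sum_pos)
    fix i show "0 < g $ i + 1" using assms[rule_format, of i] by simp
  qed auto
  then show ?thesis by (simp add: entry_sum_def sum.distrib)
qed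

lemma LT_domain_sets [measurable]: "(LT_domain :: ('m::finite, 'n::finite) dom set) \<in> sets borel"
  and simplex_set_sets [measurable]: "(simplex_set :: (real ^ 'n) set) \<in> sets borel"
proof -
  have c: "continuous_on UNIV (entry_sum :: real ^ 'n \<Rightarrow> real)"
    unfolding entry_sum_def[abs_def] by (intro continuous_intros)
  have "closed (simplex_set :: (real ^ 'n) set)"
    unfolding simplex_set_def
    by (intro closed_Collect_conj closed_Collect_all closed_Collect_le continuous_intros c)
  moreover have "closed ({x. \<forall>i. 0 \<le> x $ i} :: (real ^ 'm) set)"
    by (intro closed_Collect_all closed_Collect_le continuous_intros)
  ultimately show "(LT_domain :: ('m::finite, 'n::finite) dom set) \<in> sets borel"
      "(simplex_set :: (real ^ 'n) set) \<in> sets borel"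
    unfolding LT_domain_def by (auto intro!: borel_closed closed_Times)
qed

lemma measurable_LT_weight [measurable]: "LT_weight \<gamma> \<kappa> \<in> borel_measurable borel"
  unfolding LT_weight_def case_prod_beta borel_prod[symmetric] by measurable

lemma LT_weight_nonneg: "LT_weight \<gamma> \<kappa> z \<ge> 0"
  by (auto simp: LT_weight_def case_prod_beta intro!: mult_nonneg_nonneg prod_nonneg)

text \<open>Scaling $x$ by $1-|y|$ evaluates the inner integral over $x$; it contributes the power
  $|\gamma| + d_1$ of $1-|y|$ and leaves a Dirichlet integral in $y$. Where $|y| = 1$ the integrand
  vanishes on both sides because zero to any real power is zero.\<close>
lemma nn_integral_LT_weight:
  fixes \<gamma> :: "real ^ 'm::finite" and \<kappa> :: "real ^ ('n::finite option)"
  assumes \<gamma>: "\<forall>i. \<gamma> $ i > -1" and \<kappa>: "\<forall>j. \<kappa> $ j > -1"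
  shows "(\<integral>\<^sup>+z. ennreal (indicator LT_domain z * LT_weight \<gamma> \<kappa> z) \<partial>lborel)
      = ennreal (LT_moment \<gamma> \<kappa>)"
proof -
  let ?A = "\<kappa> $ None + entry_sum \<gamma> + real CARD('m)"
  define k where "k = (\<chi> j. \<kappa> $ Some j)"
  define q where "q y = (\<Prod>j\<in>UNIV. (y $ j) powr (k $ j))" for y :: "real ^ 'n"
  have q0: "q y \<ge> 0" for y by (auto simp: q_def intro: prod_nonneg)
  let ?C = "\<Prod>i\<in>UNIV. Gamma (\<gamma> $ i + 1)"
  have C: "?C \<ge> 0"
  proof (intro prod_nonneg ballI)
    fix i have "\<gamma> $ i + 1 > 0" using \<gamma>[rule_format, of i] by simp
    from Gamma_real_pos[OF this] show "0 \<le> Gamma (\<gamma> $ i + 1)" by simp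
  qed
  have A: "?A > -1" using entry_sum_add_card_pos[OF \<gamma>] \<kappa>[rule_format, of None] by linarith
  have inner: "(\<integral>\<^sup>+x. ennreal (indicator LT_domain (x, y) * LT_weight \<gamma> \<kappa> (x, y)) \<partial>lborel)
     = ennreal ?C * ennreal (indicator simplex_set y
         * ((\<Prod>j\<in>UNIV. (y $ j) powr (k $ j)) * (1 - entry_sum y) powr ?A))"
    for y :: "real ^ 'n"
  proof (cases "y \<in> simplex_set \<and> entry_sum y < 1")
    case True
    let ?s = "1 - entry_sum y"
    let ?g = "\<lambda>x. ennreal (indicator orthant x
        * ((\<Prod>i\<in>UNIV. (x $ i) powr (\<gamma> $ i)) * exp (- (entry_sum x / ?s))))"
    have [measurable]: "?g \<in> borel_measurable borel"
      by measurable
    have "(\<integral>\<^sup>+x. ennreal (indicator LT_domain (x, y) * LT_weight \<gamma> \<kappa> (x, y)) \<partial>lborel)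
      = (\<integral>\<^sup>+x. ennreal (q y * ?s powr (\<kappa> $ None)) * ?g x \<partial>lborel)"
      using True q0
      by (intro nn_integral_cong)
         (auto simp: LT_domain_def orthant_def LT_weight_def indicator_def q_def k_def mult_ac
             prod_nonneg simp flip: ennreal_mult)
    also have "\<dots> = ennreal (q y * ?s powr (\<kappa> $ None)) * (\<integral>\<^sup>+x. ?g x \<partial>lborel)"
      by (rule nn_integral_cmult) measurable
    also have "\<dots> = ennreal (q y * ?s powr (\<kappa> $ None))
        * ennreal (?C * ?s powr (entry_sum \<gamma> + real CARD('m)))"
      using True by (subst nn_integral_Gamma_vec[OF \<gamma>]) auto
    also have "\<dots> = ennreal ?C * ennreal (q y * ?s powr ?A)"
      using True q0 C by (simp add: powr_add mult_ac flip: ennreal_mult)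
    finally show ?thesis using True by (simp add: q_def)
  next
    case False
    then have "ennreal (indicator LT_domain (x, y) * LT_weight \<gamma> \<kappa> (x, y)) = 0" for x
      by (auto simp: LT_domain_def LT_weight_def indicator_def simplex_set_def)
    moreover have "indicator simplex_set y * (1 - entry_sum y) powr ?A = 0"
      using False by (auto simp: indicator_def simplex_set_def)
    ultimately show ?thesis by auto
  qed
  have "(\<integral>\<^sup>+z. ennreal (indicator LT_domain z * LT_weight \<gamma> \<kappa> z) \<partial>lborel)
      = (\<integral>\<^sup>+z. ennreal (indicator LT_domain z * LT_weight \<gamma> \<kappa> z) \<partial>(lborel \<Otimes>\<^sub>M lborel))"
    by (simp add: lborel_prod)
  also have "\<dots> = (\<integral>\<^sup>+y. \<integral>\<^sup>+x. ennreal (indicator LT_domain (x, y) * LT_weight \<gamma> \<kappa> (x, y)) \<partial>lborel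
      \<partial>lborel)"
    by (rule lborel_pair.nn_integral_snd[symmetric]) (simp add: lborel_prod)
  also have "\<dots> = ennreal ?C * ennreal ((\<Prod>j\<in>UNIV. Gamma (k $ j + 1))
      * Gamma (?A + 1) / Gamma (entry_sum k + real CARD('n) + ?A + 1))"
    unfolding inner using \<kappa> A
    by (subst nn_integral_cmult, measurable, subst nn_integral_Dirichlet) (auto simp: k_def)
  also have "\<dots> = ennreal (LT_moment \<gamma> \<kappa>)"
    unfolding LT_moment_def entry_sum_option
    by (subst ennreal_mult'[symmetric]) (use C in \<open>simp_all add: k_def entry_sum_def algebra_simps\<close>)
  finally show ?thesis .
qed

lemma prod_Gamma_Suc:
  fixes g :: "'k::finite \<Rightarrow> real"
  assumes "g i > -1" "\<And>k. h k = (if k = i then g k + 1 else g k)"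
  shows "(\<Prod>k\<in>UNIV. Gamma (h k + 1)) = (g i + 1) * (\<Prod>k\<in>UNIV. Gamma (g k + 1))"
proof -
  have "g i + 1 \<notin> \<int>\<^sub>\<le>\<^sub>0" using assms(1) by (auto elim!: nonpos_Ints_cases)
  then have "Gamma (h i + 1) = (g i + 1) * Gamma (g i + 1)"
    using Gamma_plus1[of "g i + 1"] assms by (simp add: assms(2))
  then show ?thesis
    by (subst (1 2) prod.remove[of _ i]) (simp_all add: assms(2))
qed

text \<open>Raising one parameter by 1 multiplies the integrand by $x_i$, by $1-|y|$ or by $y_j$
  respectively, so these consequences of $\Gamma(t+1) = t\,\Gamma(t)$ are relations between
  neighbouring moments.\<close>
lemma LT_moment_axis:
  fixes \<gamma> :: "real ^ 'm::finite" and \<kappa> :: "real ^ ('n::finite option)"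
  assumes \<gamma>: "\<forall>i. \<gamma> $ i > -1" and \<kappa>: "\<forall>j. \<kappa> $ j > -1"
  defines "A \<equiv> \<kappa> $ None + entry_sum \<gamma> + real CARD('m)"
    and "l \<equiv> entry_sum \<kappa> + entry_sum \<gamma> + real CARD('m) + real CARD('n)"
  shows "LT_moment (\<gamma> + axis i 1) \<kappa> = (\<gamma> $ i + 1) * LT_moment \<gamma> (\<kappa> + axis None 1)"
    and "(l + 1) * LT_moment \<gamma> (\<kappa> + axis None 1) = (A + 1) * LT_moment \<gamma> \<kappa>"
    and "(l + 1) * LT_moment \<gamma> (\<kappa> + axis (Some j) 1) = (\<kappa> $ Some j + 1) * LT_moment \<gamma> \<kappa>"
proof -
  have A: "A > -1" using entry_sum_add_card_pos[OF \<gamma>] \<kappa>[rule_format, of None] by (simp add: A_def)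
  have l: "l > -1" using entry_sum_add_card_pos[OF \<gamma>] entry_sum_add_card_pos[OF \<kappa>]
    by (simp add: l_def)
  have "A + 1 \<notin> \<int>\<^sub>\<le>\<^sub>0" using A by (auto elim!: nonpos_Ints_cases)
  then have GA: "Gamma (A + 2) = (A + 1) * Gamma (A + 1)"
    using Gamma_plus1[of "A + 1"] by (simp add: add.assoc)
  have "l + 1 \<notin> \<int>\<^sub>\<le>\<^sub>0" using l by (auto elim!: nonpos_Ints_cases)
  then have Gl: "Gamma (l + 2) = (l + 1) * Gamma (l + 1)"
    using Gamma_plus1[of "l + 1"] by (simp add: add.assoc)
  have G0: "Gamma (l + 1) > 0" "l + 1 > 0" using l Gamma_real_pos[of "l + 1"] by auto
  have c: "(l + 1) * (x / ((l + 1) * y)) = x / y" for x y :: real using G0 by simp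
  have ea: "entry_sum (v + axis i 1) = entry_sum v + 1" for v :: "real ^ 'k::finite" and i
    by (simp add: entry_sum_def sum.distrib axis_def)
  have s: "\<kappa> $ None + 1 + entry_sum \<gamma> + real CARD('m) + 1 = A + 2"
    "\<kappa> $ None + (entry_sum \<gamma> + 1) + real CARD('m) + 1 = A + 2"
    "\<kappa> $ None + entry_sum \<gamma> + real CARD('m) + 1 = A + 1"
    "entry_sum \<kappa> + 1 + entry_sum \<gamma> + real CARD('m) + real CARD('n) + 1 = l + 2"
    "entry_sum \<kappa> + (entry_sum \<gamma> + 1) + real CARD('m) + real CARD('n) + 1 = l + 2"
    "entry_sum \<kappa> + entry_sum \<gamma> + real CARD('m) + real CARD('n) + 1 = l + 1"
    by (simp_all add: A_def l_def)
  have p1: "(\<Prod>k\<in>UNIV. Gamma ((\<gamma> + axis i 1) $ k + 1)) = (\<gamma> $ i + 1) * (\<Prod>k\<in>UNIV. Gamma (\<gamma> $ k + 1))"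
    using \<gamma> by (intro prod_Gamma_Suc) (auto simp: axis_def)
  have p2: "(\<Prod>k\<in>UNIV. Gamma ((\<kappa> + axis (Some j) 1) $ Some k + 1))
      = (\<kappa> $ Some j + 1) * (\<Prod>k\<in>UNIV. Gamma (\<kappa> $ Some k + 1))"
    using \<kappa> by (intro prod_Gamma_Suc[where g = "\<lambda>k. \<kappa> $ Some k"]) (auto simp: axis_def)
  have n: "(\<kappa> + axis (Some j) 1) $ None = \<kappa> $ None" "(\<kappa> + axis None 1) $ None = \<kappa> $ None + 1"
    "(\<kappa> + axis None 1) $ Some k = \<kappa> $ Some k" for k
    by (auto simp: axis_def)
  show "LT_moment (\<gamma> + axis i 1) \<kappa> = (\<gamma> $ i + 1) * LT_moment \<gamma> (\<kappa> + axis None 1)"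
    unfolding LT_moment_def ea p1 n s by simp
  show "(l + 1) * LT_moment \<gamma> (\<kappa> + axis None 1) = (A + 1) * LT_moment \<gamma> \<kappa>"
    unfolding LT_moment_def ea n s GA Gl c by simp
  show "(l + 1) * LT_moment \<gamma> (\<kappa> + axis (Some j) 1) = (\<kappa> $ Some j + 1) * LT_moment \<gamma> \<kappa>"
    unfolding LT_moment_def ea p2 n s Gl c by simp
qed

section \<open>Linear operators on polynomials\<close>

abbreviation "polyfun \<equiv> real_polynomial_function"

lemma polys_le_induct [consumes 1, case_names monomial add cmult]:
  assumes "f \<in> polys_le N"
    and mono: "\<And>a. a \<in> multi_indices_le N \<Longrightarrow> P (monomial_fun a)"
    and add: "\<And>f g. f \<in> polys_le N \<Longrightarrow> g \<in> polys_le N \<Longrightarrow> P f \<Longrightarrow> P g \<Longrightarrow> P (\<lambda>z. f z + g z)"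
    and cmult: "\<And>c f. f \<in> polys_le N \<Longrightarrow> P f \<Longrightarrow> P (\<lambda>z. c * f z)"
  shows "P f"
proof -
  obtain c where f: "f = (\<lambda>z. \<Sum>a\<in>multi_indices_le N. c a * monomial_fun a z)"
    using assms(1) by (auto simp: polys_le_def)
  have z: "P (\<lambda>z. 0)"
  proof -
    have "(\<lambda>_. 0, \<lambda>_. 0) \<in> multi_indices_le N" by (simp add: multi_indices_le_def)
    from cmult[OF polys_le_monomial[OF this] mono[OF this], of 0] show ?thesis by simp
  qed
  have "P (\<lambda>z. \<Sum>a\<in>S. c a * monomial_fun a z)" if "S \<subseteq> multi_indices_le N" for S
    using finite_subset[OF that finite_multi_indices_le] that
  proof induction
    case (insert a S)
    then show ?case
      by (auto intro!: add cmult mono polys_le_sum polys_le_cmult polys_le_monomial)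
  qed (simp add: z)
  then show ?thesis unfolding f by simp
qed

lemma poly_induct [consumes 1, case_names monomial add cmult]:
  assumes "polyfun f"
    and "\<And>a. P (monomial_fun a)"
    and "\<And>f g. polyfun f \<Longrightarrow> polyfun g \<Longrightarrow> P f \<Longrightarrow> P g \<Longrightarrow> P (\<lambda>z. f z + g z)"
    and "\<And>c f. polyfun f \<Longrightarrow> P f \<Longrightarrow> P (\<lambda>z. c * f z)"
  shows "P f"
proof -
  obtain N where "f \<in> polys_le N" using assms(1) real_polynomial_function_iff_polys_le by blast
  then show ?thesis
  proof (induction rule: polys_le_induct)
    case (monomial a)
    show ?case by (rule assms(2))
  next
    case (add f g)
    then show ?case using real_polynomial_function_iff_polys_le by (intro assms(3)) auto
  next
    case (cmult c f)
    then show ?case using real_polynomial_function_iff_polys_le by (intro assms(4)) auto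
  qed
qed

lemma poly_monomial [simp]: "polyfun (monomial_fun a)"
proof -
  have "a \<in> multi_indices_le (sum (fst a) UNIV + sum (snd a) UNIV)"
      by (auto simp: multi_indices_le_def)
  from polys_le_monomial[OF this] show ?thesis using real_polynomial_function_iff_polys_le by blast
qed

lemma poly_fst [simp]: "polyfun (\<lambda>z :: ('m::finite, 'n::finite) dom. fst z $ i)"
  and poly_snd [simp]: "polyfun (\<lambda>z :: ('m, 'n) dom. snd z $ j)"
  using polys_le_fst polys_le_snd real_polynomial_function_iff_polys_le by blast+

lemma polys_le_polyfun: "f \<in> polys_le N \<Longrightarrow> polyfun f"
  using real_polynomial_function_iff_polys_le by blast

lemma polys_le_total_degree: "polyfun f \<Longrightarrow> f \<in> polys_le (total_degree f)"
  unfolding total_degree_def real_polynomial_function_iff_polys_le by (rule LeastI_ex)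

lemma total_degree_le: "f \<in> polys_le N \<Longrightarrow> total_degree f \<le> N"
  unfolding total_degree_def by (rule Least_le)

lemmas poly_intros = real_polynomial_function.intros(2-4) real_polynomial_function_sum poly_fst
    poly_snd
  real_polynomial_function_diff real_polynomial_function_minus finite

text \<open>Linearity is only required on polynomials, since the derivative of an arbitrary function is
  additive only where the summands are differentiable; preservation of polynomials makes the notion
  closed under composition.\<close>
definition lin_op :: "((('m::finite, 'n::finite) dom \<Rightarrow> real) \<Rightarrow> ('m, 'n) dom \<Rightarrow> real) \<Rightarrow> bool" where
  "lin_op T \<longleftrightarrow> (\<forall>f. polyfun f \<longrightarrow> polyfun (T f)) \<and>
     (\<forall>f g. polyfun f \<longrightarrow> polyfun g \<longrightarrow> T (\<lambda>z. f z + g z) = (\<lambda>z. T f z + T g z)) \<and>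
     (\<forall>c f. polyfun f \<longrightarrow> T (\<lambda>z. c * f z) = (\<lambda>z. c * T f z))"

lemma lin_opI:
  assumes "\<And>f. polyfun f \<Longrightarrow> polyfun (T f)"
    "\<And>f g. polyfun f \<Longrightarrow> polyfun g \<Longrightarrow> T (\<lambda>z. f z + g z) = (\<lambda>z. T f z + T g z)"
    "\<And>c f. polyfun f \<Longrightarrow> T (\<lambda>z. c * f z) = (\<lambda>z. c * T f z)"
  shows "lin_op T"
  using assms by (simp add: lin_op_def)

lemma lin_poly: "lin_op T \<Longrightarrow> polyfun f \<Longrightarrow> polyfun (T f)"
  and lin_plus: "lin_op T \<Longrightarrow> polyfun f \<Longrightarrow> polyfun g \<Longrightarrow> T (\<lambda>z. f z + g z) = (\<lambda>z. T f z + T g z)"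
  and lin_scale: "lin_op T \<Longrightarrow> polyfun f \<Longrightarrow> T (\<lambda>z. c * f z) = (\<lambda>z. c * T f z)"
  by (auto simp: lin_op_def)

lemma lin_minus:
  assumes "lin_op T" "polyfun f" "polyfun g"
  shows "T (\<lambda>z. f z - g z) = (\<lambda>z. T f z - T g z)"
  using lin_plus[OF assms(1,2), of "\<lambda>z. (-1) * g z"] lin_scale[OF assms(1,3), of "-1"] assms(3)
  by (simp add: real_polynomial_function_minus)

lemma lin_id: "lin_op (\<lambda>f. f)" by (simp add: lin_op_def)

lemma lin_add: "lin_op T \<Longrightarrow> lin_op U \<Longrightarrow> lin_op (\<lambda>f z. T f z + U f z)"
  by (auto simp: lin_op_def algebra_simps intro!: poly_intros)

lemma lin_diff: "lin_op T \<Longrightarrow> lin_op U \<Longrightarrow> lin_op (\<lambda>f z. T f z - U f z)"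
  by (auto simp: lin_op_def algebra_simps intro!: poly_intros)

lemma lin_mult_left: "polyfun h \<Longrightarrow> lin_op T \<Longrightarrow> lin_op (\<lambda>f z. h z * T f z)"
  by (auto simp: lin_op_def algebra_simps intro!: poly_intros)

lemma lin_mult_right: "polyfun h \<Longrightarrow> lin_op T \<Longrightarrow> lin_op (\<lambda>f z. T f z * h z)"
  by (auto simp: lin_op_def algebra_simps intro!: poly_intros)

lemma lin_const_mult: "lin_op T \<Longrightarrow> lin_op (\<lambda>f z. c * T f z)"
  by (rule lin_mult_left) (auto intro: poly_intros)

lemma lin_sum: "(\<And>i. lin_op (T i)) \<Longrightarrow> lin_op (\<lambda>f z. \<Sum>i\<in>(UNIV :: 'i::finite set). T i f z)"
  by (auto simp: lin_op_def sum.distrib sum_distrib_left intro!: poly_intros)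

lemma lin_comp: "lin_op T \<Longrightarrow> lin_op U \<Longrightarrow> lin_op (\<lambda>f. T (U f))"
  by (auto simp: lin_op_def)

lemma differentiable_along_line:
  fixes f :: "('m::finite, 'n::finite) dom \<Rightarrow> real"
  assumes "polyfun f"
  shows "(\<lambda>t. f (z + t *\<^sub>R v)) field_differentiable (at 0)"
proof -
  have "polynomial_function (\<lambda>t::real. z + t *\<^sub>R v)"
    by (intro polynomial_function_add polynomial_function_const polynomial_function_bounded_linear
        bounded_linear_scaleR_left)
  from real_polynomial_function_compose[OF this assms]
  have "polyfun (\<lambda>t. f (z + t *\<^sub>R v))" by (simp add: o_def)
  from has_real_derivative_polynomial_function[OF this] show ?thesis
    by (auto simp: field_differentiable_def)
qed

lemma pdx_alt: "pdx i f z = deriv (\<lambda>t. f (z + t *\<^sub>R (axis i 1, 0))) 0"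
  and pdy_alt: "pdy j f z = deriv (\<lambda>t. f (z + t *\<^sub>R (0, axis j 1))) 0"
  by (auto simp: pdx_def pdy_def case_prod_beta plus_prod_def)

lemma has_field_derivative_prod_powers:
  fixes x :: "real ^ 'k::finite"
  shows "((\<lambda>t. \<Prod>k\<in>UNIV. ((x + t *\<^sub>R axis i 1) $ k) ^ \<alpha> k) has_field_derivative
      real (\<alpha> i) * (\<Prod>k\<in>UNIV. (x $ k) ^ (\<alpha>(i := \<alpha> i - 1)) k)) (at 0)"
proof -
  have 1: "(\<Prod>k\<in>UNIV. ((x + t *\<^sub>R axis i 1) $ k) ^ \<alpha> k)
      = (x $ i + t) ^ \<alpha> i * (\<Prod>k\<in>UNIV - {i}. (x $ k) ^ \<alpha> k)" for t
    by (subst prod.remove[of _ i]) (auto simp: axis_def intro!: prod.cong)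
  have 2: "(\<Prod>k\<in>UNIV. (x $ k) ^ (\<alpha>(i := \<alpha> i - 1)) k)
      = (x $ i) ^ (\<alpha> i - 1) * (\<Prod>k\<in>UNIV - {i}. (x $ k) ^ \<alpha> k)"
    by (subst prod.remove[of _ i]) (auto intro!: prod.cong)
  show ?thesis unfolding 1 2
    by (auto intro!: derivative_eq_intros)
qed

text \<open>If the exponent is 0, the truncated subtraction produces a wrong monomial, but then its
  coefficient is 0. The same convention is used in all formulas for monomials below.\<close>
lemma pdx_monomial: "pdx i (monomial_fun (\<alpha>, \<beta>))
    = (\<lambda>z. real (\<alpha> i) * monomial_fun (\<alpha>(i := \<alpha> i - 1), \<beta>) z)"
proof
  fix z :: "('a, 'b) dom"
  obtain x y where z: "z = (x, y)" by (cases z)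
  show "pdx i (monomial_fun (\<alpha>, \<beta>)) z = real (\<alpha> i) * monomial_fun (\<alpha>(i := \<alpha> i - 1), \<beta>) z"
    unfolding z pdx_def monomial_fun_def prod.case
    using DERIV_imp_deriv[OF DERIV_cmult_right[OF has_field_derivative_prod_powers[of x i \<alpha>],
        of "\<Prod>j\<in>UNIV. (y $ j) ^ \<beta> j"]]
    by (simp del: fun_upd_apply add: mult.assoc)
qed

lemma pdy_monomial: "pdy j (monomial_fun (\<alpha>, \<beta>))
    = (\<lambda>z. real (\<beta> j) * monomial_fun (\<alpha>, \<beta>(j := \<beta> j - 1)) z)"
proof
  fix z :: "('a, 'b) dom"
  obtain x y where z: "z = (x, y)" by (cases z)
  show "pdy j (monomial_fun (\<alpha>, \<beta>)) z = real (\<beta> j) * monomial_fun (\<alpha>, \<beta>(j := \<beta> j - 1)) z"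
    unfolding z pdy_def monomial_fun_def prod.case
    using DERIV_imp_deriv[OF DERIV_cmult[OF has_field_derivative_prod_powers[of y j \<beta>],
        of "\<Prod>i\<in>UNIV. (x $ i) ^ \<alpha> i"]]
    by (simp del: fun_upd_apply add: mult.left_commute)
qed

lemma lin_pd_aux:
  fixes D :: "(('m::finite, 'n::finite) dom \<Rightarrow> real) \<Rightarrow> ('m, 'n) dom \<Rightarrow> real"
  assumes D: "\<And>f z. D f z = deriv (\<lambda>t. f (z + t *\<^sub>R v)) 0"
    and mono: "\<And>\<alpha> \<beta>. polyfun (D (monomial_fun (\<alpha>, \<beta>)))"
  shows "lin_op D"
proof -
  have add: "D (\<lambda>z. f z + g z) = (\<lambda>z. D f z + D g z)" if "polyfun f" "polyfun g" for f g
    unfolding fun_eq_iff D using that by (auto intro!: deriv_add differentiable_along_line)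
  have cmult: "D (\<lambda>z. c * f z) = (\<lambda>z. c * D f z)" if "polyfun f" for c f
    unfolding fun_eq_iff D using that by (auto intro!: deriv_cmult differentiable_along_line)
  have pol: "polyfun (D f)" if "polyfun f" for f
    using that
  proof (induction rule: poly_induct)
    case (monomial a)
    then show ?case using mono by (cases a) simp
  qed (simp_all add: add cmult real_polynomial_function.intros)
  show ?thesis
  proof (rule lin_opI)
    show "polyfun f \<Longrightarrow> polyfun (D f)" for f by (rule pol)
    show "polyfun f \<Longrightarrow> polyfun g \<Longrightarrow> D (\<lambda>z. f z + g z) = (\<lambda>z. D f z + D g z)" for f g by (rule add)
    show "polyfun f \<Longrightarrow> D (\<lambda>z. c * f z) = (\<lambda>z. c * D f z)" for c f by (rule cmult)
  qed
qed

lemma lin_pdx: "lin_op (pdx i)"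
proof (rule lin_pd_aux)
  show "pdx i f z = deriv (\<lambda>t. f (z + t *\<^sub>R (axis i 1, 0))) 0" for f z by (rule pdx_alt)
  show "polyfun (pdx i (monomial_fun (\<alpha>, \<beta>)))" for \<alpha> \<beta>
    unfolding pdx_monomial
    by (intro real_polynomial_function.intros(2,4) poly_monomial)
qed

lemma lin_pdy: "lin_op (pdy j)"
proof (rule lin_pd_aux)
  show "pdy j f z = deriv (\<lambda>t. f (z + t *\<^sub>R (0, axis j 1))) 0" for f z by (rule pdy_alt)
  show "polyfun (pdy j (monomial_fun (\<alpha>, \<beta>)))" for \<alpha> \<beta>
    unfolding pdy_monomial
    by (intro real_polynomial_function.intros(2,4) poly_monomial)
qed

lemma eulerx_alt: "eulerx f z = (\<Sum>i\<in>UNIV. fst z $ i * pdx i f z)"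
  and eulery_alt: "eulery f z = (\<Sum>j\<in>UNIV. snd z $ j * pdy j f z)"
  and Lx_alt: "Lx \<gamma> f z = (\<Sum>i\<in>UNIV. fst z $ i * pdx i (pdx i f) z + (\<gamma> $ i + 1) * pdx i f z)"
  and Ly_alt: "Ly \<kappa> f z = (\<Sum>j\<in>UNIV. snd z $ j * pdy j (pdy j f) z + (\<kappa> $ Some j + 1) * pdy j f z)"
  by (auto simp: eulerx_def eulery_def Lx_def Ly_def case_prod_beta)

text \<open>The barycentric coordinate of the simplex that belongs to the last entry of $\kappa$.\<close>
definition slack :: "('m::finite, 'n::finite) dom \<Rightarrow> real" where "slack z = 1 - entry_sum (snd z)"

lemma poly_slack [simp]: "polyfun slack"
  unfolding slack_def[abs_def] entry_sum_def by (intro poly_intros)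

lemma lin_eulerx: "lin_op eulerx"
  unfolding eulerx_alt[abs_def] by (intro lin_sum lin_mult_left lin_pdx poly_fst)

lemma lin_eulery: "lin_op eulery"
  unfolding eulery_alt[abs_def] by (intro lin_sum lin_mult_left lin_pdy poly_snd)

lemma lin_euler: "lin_op euler"
  unfolding euler_def[abs_def] by (intro lin_add lin_eulerx lin_eulery)

lemma lin_Lx: "lin_op (Lx \<gamma>)"
  unfolding Lx_alt[abs_def]
  by (intro lin_sum lin_add lin_mult_left[OF poly_fst] lin_const_mult lin_pdx
      lin_comp[OF lin_pdx lin_pdx])

lemma lin_Ly: "lin_op (Ly \<kappa>)"
  unfolding Ly_alt[abs_def]
  by (intro lin_sum lin_add lin_mult_left[OF poly_snd] lin_const_mult lin_pdy
      lin_comp[OF lin_pdy lin_pdy])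

lemma LT_operator_alt: "LT_operator (\<gamma> :: real ^ 'm::finite) (\<kappa> :: real ^ ('n::finite option)) f z =
     (Lx \<gamma> (eulerx f) z + eulerx (Lx \<gamma> f) z - slack z * Lx \<gamma> (Lx \<gamma> f) z
     + (\<kappa> $ None + entry_sum \<gamma> + real CARD('m)) * Lx \<gamma> f z + Ly \<kappa> f z)
     - (euler (euler f) z + (entry_sum \<kappa> + entry_sum \<gamma> + real CARD('m) + real CARD('n))
         * euler f z)"
  by (simp add: LT_operator_def case_prod_beta slack_def algebra_simps)

lemma lin_LT_operator: "lin_op (LT_operator \<gamma> \<kappa>)"
  unfolding LT_operator_alt[abs_def]
  by (intro lin_add lin_diff lin_const_mult lin_mult_left[OF poly_slack]
      lin_comp[OF lin_Lx lin_eulerx] lin_comp[OF lin_eulerx lin_Lx]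
      lin_comp[OF lin_Lx lin_Lx] lin_Lx lin_Ly lin_euler lin_comp[OF lin_euler lin_euler])

section \<open>Action of the operators on monomials\<close>

lemma prod_power_upd:
  fixes x :: "real ^ 'k::finite"
  shows "x $ i * (\<Prod>k\<in>UNIV. (x $ k) ^ \<alpha> k) = (\<Prod>k\<in>UNIV. (x $ k) ^ (\<alpha>(i := Suc (\<alpha> i))) k)"
  by (subst (1 2) prod.remove[of _ i]) (auto intro!: prod.cong)

lemma fst_times_monomial: "fst z $ i * monomial_fun (\<alpha>, \<beta>) z
    = monomial_fun (\<alpha>(i := Suc (\<alpha> i)), \<beta>) z"
  using prod_power_upd[of "fst z" i \<alpha>]
  by (simp add: monomial_fun_def case_prod_beta mult.assoc[symmetric] del: fun_upd_apply)

lemma snd_times_monomial: "snd z $ j * monomial_fun (\<alpha>, \<beta>) z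
    = monomial_fun (\<alpha>, \<beta>(j := Suc (\<beta> j))) z"
  using prod_power_upd[of "snd z" j \<beta>]
  by (simp add: monomial_fun_def case_prod_beta mult.left_commute del: fun_upd_apply)

lemma eulerx_monomial: "eulerx (monomial_fun (\<alpha>, \<beta>))
    = (\<lambda>z. real (sum \<alpha> UNIV) * monomial_fun (\<alpha>, \<beta>) z)"
proof
  fix z :: "('a, 'b) dom"
  have "fst z $ i * (real (\<alpha> i) * monomial_fun (\<alpha>(i := \<alpha> i - 1), \<beta>) z)
      = real (\<alpha> i) * monomial_fun (\<alpha>, \<beta>) z" for i
    using fst_times_monomial[of z i "\<alpha>(i := \<alpha> i - 1)" \<beta>]
        by (cases "\<alpha> i") (simp_all add: fun_upd_idem)
  then show "eulerx (monomial_fun (\<alpha>, \<beta>)) z = real (sum \<alpha> UNIV) * monomial_fun (\<alpha>, \<beta>) z"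
    by (simp only: eulerx_alt pdx_monomial of_nat_sum sum_distrib_right)
qed

lemma eulery_monomial: "eulery (monomial_fun (\<alpha>, \<beta>))
    = (\<lambda>z. real (sum \<beta> UNIV) * monomial_fun (\<alpha>, \<beta>) z)"
proof
  fix z :: "('a, 'b) dom"
  have "snd z $ i * (real (\<beta> i) * monomial_fun (\<alpha>, \<beta>(i := \<beta> i - 1)) z)
      = real (\<beta> i) * monomial_fun (\<alpha>, \<beta>) z" for i
    using snd_times_monomial[of z i \<alpha> "\<beta>(i := \<beta> i - 1)"]
        by (cases "\<beta> i") (simp_all add: fun_upd_idem)
  then show "eulery (monomial_fun (\<alpha>, \<beta>)) z = real (sum \<beta> UNIV) * monomial_fun (\<alpha>, \<beta>) z"
    by (simp only: eulery_alt pdy_monomial of_nat_sum sum_distrib_right)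
qed

lemma euler_monomial:
  "euler (monomial_fun (\<alpha>, \<beta>)) = (\<lambda>z. real (sum \<alpha> UNIV + sum \<beta> UNIV) * monomial_fun (\<alpha>, \<beta>) z)"
  by (simp add: euler_def eulerx_monomial eulery_monomial algebra_simps)

text \<open>$x_i\partial_i^2 + (\gamma_i+1)\partial_i$ maps $x_i^k$ to
  $\big(k(k-1) + (\gamma_i+1)k\big)x_i^{k-1} = k(k+\gamma_i)\,x_i^{k-1}$.\<close>
lemma Lx_monomial: "Lx \<gamma> (monomial_fun (\<alpha>, \<beta>)) =
    (\<lambda>z. \<Sum>i\<in>UNIV. real (\<alpha> i) * (real (\<alpha> i) + \<gamma> $ i) * monomial_fun (\<alpha>(i := \<alpha> i - 1), \<beta>) z)"
proof
  fix z :: "('a, 'b) dom"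
  have "fst z $ i * (real (\<alpha> i) * (real (\<alpha> i - 1) * monomial_fun (\<alpha>(i := \<alpha> i - 1 - 1), \<beta>) z))
      + (\<gamma> $ i + 1) * (real (\<alpha> i) * monomial_fun (\<alpha>(i := \<alpha> i - 1), \<beta>) z)
      = real (\<alpha> i) * (real (\<alpha> i) + \<gamma> $ i) * monomial_fun (\<alpha>(i := \<alpha> i - 1), \<beta>) z" for i
  proof (cases "\<alpha> i \<ge> 2")
    case True
    then have e: "Suc (\<alpha> i - 1 - 1) = \<alpha> i - 1" by arith
    have h: "fst z $ i * monomial_fun (\<alpha>(i := \<alpha> i - 1 - 1), \<beta>) z
        = monomial_fun (\<alpha>(i := \<alpha> i - 1), \<beta>) z"
      using fst_times_monomial[of z i "\<alpha>(i := \<alpha> i - 1 - 1)" \<beta>] e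
          by (simp only: fun_upd_same fun_upd_upd)
    have "fst z $ i * (real (\<alpha> i) * (real (\<alpha> i - 1) * monomial_fun (\<alpha>(i := \<alpha> i - 1 - 1), \<beta>) z))
        = real (\<alpha> i) * real (\<alpha> i - 1) * monomial_fun (\<alpha>(i := \<alpha> i - 1), \<beta>) z"
      by (simp only: h[symmetric] mult_ac)
    then show ?thesis using True by (simp add: of_nat_diff algebra_simps)
  next
    case False
    then have "\<alpha> i = 0 \<or> \<alpha> i = 1" by linarith
    then show ?thesis by (auto simp: algebra_simps)
  qed
  then show "Lx \<gamma> (monomial_fun (\<alpha>, \<beta>)) z = (\<Sum>i\<in>UNIV. real (\<alpha> i) * (real (\<alpha> i) + \<gamma> $ i)
      * monomial_fun (\<alpha>(i := \<alpha> i - 1), \<beta>) z)"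
    by (simp add: Lx_alt pdx_monomial lin_scale[OF lin_pdx])
qed

lemma Ly_monomial: "Ly \<kappa> (monomial_fun (\<alpha>, \<beta>)) =
    (\<lambda>z. \<Sum>j\<in>UNIV. real (\<beta> j) * (real (\<beta> j) + \<kappa> $ Some j) * monomial_fun (\<alpha>, \<beta>(j := \<beta> j - 1)) z)"
proof
  fix z :: "('a, 'b) dom"
  have "snd z $ i * (real (\<beta> i) * (real (\<beta> i - 1) * monomial_fun (\<alpha>, \<beta>(i := \<beta> i - 1 - 1)) z))
      + (\<kappa> $ Some i + 1) * (real (\<beta> i) * monomial_fun (\<alpha>, \<beta>(i := \<beta> i - 1)) z)
      = real (\<beta> i) * (real (\<beta> i) + \<kappa> $ Some i) * monomial_fun (\<alpha>, \<beta>(i := \<beta> i - 1)) z" for i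
  proof (cases "\<beta> i \<ge> 2")
    case True
    then have e: "Suc (\<beta> i - 1 - 1) = \<beta> i - 1" by arith
    have h: "snd z $ i * monomial_fun (\<alpha>, \<beta>(i := \<beta> i - 1 - 1)) z
        = monomial_fun (\<alpha>, \<beta>(i := \<beta> i - 1)) z"
      using snd_times_monomial[of z i \<alpha> "\<beta>(i := \<beta> i - 1 - 1)"] e
          by (simp only: fun_upd_same fun_upd_upd)
    have "snd z $ i * (real (\<beta> i) * (real (\<beta> i - 1) * monomial_fun (\<alpha>, \<beta>(i := \<beta> i - 1 - 1)) z))
        = real (\<beta> i) * real (\<beta> i - 1) * monomial_fun (\<alpha>, \<beta>(i := \<beta> i - 1)) z"
      by (simp only: h[symmetric] mult_ac)
    then show ?thesis using True by (simp add: of_nat_diff algebra_simps)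
  next
    case False
    then have "\<beta> i = 0 \<or> \<beta> i = 1" by linarith
    then show ?thesis by (auto simp: algebra_simps)
  qed
  then show "Ly \<kappa> (monomial_fun (\<alpha>, \<beta>)) z = (\<Sum>j\<in>UNIV. real (\<beta> j) * (real (\<beta> j) + \<kappa> $ Some j)
      * monomial_fun (\<alpha>, \<beta>(j := \<beta> j - 1)) z)"
    by (simp add: Ly_alt pdy_monomial lin_scale[OF lin_pdy])
qed

lemma sum_dec: "(\<Sum>k\<in>UNIV. (\<alpha>(i := \<alpha> i - 1)) k) = sum \<alpha> (UNIV :: 'k::finite set) - 1"
    if "\<alpha> i > (0::nat)"
proof -
  have "sum \<alpha> UNIV = \<alpha> i + sum \<alpha> (UNIV - {i})" by (rule sum.remove) auto
  moreover have "(\<Sum>k\<in>UNIV. (\<alpha>(i := \<alpha> i - 1)) k) = (\<alpha> i - 1) + (\<Sum>k\<in>UNIV - {i}. (\<alpha>(i := \<alpha> i - 1)) k)"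
    by (subst sum.remove[of _ i]) auto
  moreover have "(\<Sum>k\<in>UNIV - {i}. (\<alpha>(i := \<alpha> i - 1)) k) = sum \<alpha> (UNIV - {i})" by (rule sum.cong) auto
  ultimately show ?thesis using that by simp
qed

lemma sum_pos_of_pos: "\<alpha> i > (0::nat) \<Longrightarrow> sum \<alpha> (UNIV :: 'k::finite set) \<ge> 1"
  using member_le_sum[of i UNIV \<alpha>] by simp

lemma lin_sum_scale:
  assumes "lin_op T" "\<And>i. polyfun (f i)"
  shows "T (\<lambda>z. \<Sum>i\<in>(S :: 'i::finite set). c i * f i z) = (\<lambda>z. \<Sum>i\<in>S. c i * T (f i) z)"
proof -
  have z: "T (\<lambda>z. 0) = (\<lambda>z. 0)"
    using lin_scale[OF assms(1), of "\<lambda>z. 0" 0] by (simp add: poly_intros)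
  show ?thesis
    using finite[of S]
  proof induction
    case (insert i S)
    then show ?case using assms
      by (simp add: lin_plus[OF assms(1)] lin_scale[OF assms(1)] poly_intros)
  qed (simp add: z)
qed

lemma eulerx_Lx_monomial: "eulerx (Lx \<gamma> (monomial_fun (\<alpha>, \<beta>))) =
    (\<lambda>z. (real (sum \<alpha> UNIV) - 1) * Lx \<gamma> (monomial_fun (\<alpha>, \<beta>)) z)"
proof -
  have "real (\<alpha> i) * (real (\<alpha> i) + \<gamma> $ i) * (real (\<Sum>k\<in>UNIV. (\<alpha>(i := \<alpha> i - 1)) k) * x)
      = (real (sum \<alpha> UNIV) - 1) * (real (\<alpha> i) * (real (\<alpha> i) + \<gamma> $ i) * x)" for i x
    using sum_dec[of \<alpha> i] sum_pos_of_pos[of \<alpha> i]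
        by (cases "\<alpha> i > 0") (auto simp: of_nat_diff simp del: fun_upd_apply of_nat_sum)
  then show ?thesis
    by (simp only: Lx_monomial lin_sum_scale[OF lin_eulerx poly_monomial] eulerx_monomial
        sum_distrib_left)
qed

lemma polys_le_0_const: "f \<in> polys_le 0 \<Longrightarrow> \<exists>c. f = (\<lambda>z. c)"
proof (induction rule: polys_le_induct)
  case (monomial a)
  then show ?case by (cases a) (auto simp: multi_indices_le_def monomial_fun_def fun_eq_iff)
qed auto

lemma LT_operator_const: "LT_operator \<gamma> \<kappa> (\<lambda>z. c) = (\<lambda>z. 0)"
  by (simp add: fun_eq_iff LT_operator_def Lx_def Ly_def euler_def eulerx_def eulery_def pdx_def
      pdy_def)

lemma polys_le_diff: "f \<in> polys_le N \<Longrightarrow> g \<in> polys_le N \<Longrightarrow> (\<lambda>z. f z - g z) \<in> polys_le N"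
  using polys_le_add[of f N "\<lambda>z. (-1) * g z"] polys_le_cmult[of g N "-1"] by simp

lemma eulerx_polys_le: "f \<in> polys_le N \<Longrightarrow> eulerx f \<in> polys_le N"
proof (induction rule: polys_le_induct)
  case (monomial a)
  then show ?case
    by (cases a) (simp add: eulerx_monomial polys_le_cmult polys_le_monomial del: of_nat_sum)
qed (auto simp: lin_plus[OF lin_eulerx] lin_scale[OF lin_eulerx] polys_le_polyfun intro:
    polys_le_add polys_le_cmult)

lemma slack_polys_le: "slack \<in> polys_le 1"
  unfolding slack_def[abs_def] entry_sum_def
  by (intro polys_le_diff polys_le_sum polys_le_snd polys_le_mono[OF polys_le_const]) simp

lemma Lx_polys_le: "f \<in> polys_le N \<Longrightarrow> Lx \<gamma> f \<in> polys_le (N - 1)"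
  and Ly_polys_le: "f \<in> polys_le N \<Longrightarrow> Ly \<kappa> f \<in> polys_le (N - 1)"
  and Lx_polys_le_0: "f \<in> polys_le 0 \<Longrightarrow> Lx \<gamma> f = (\<lambda>z. 0)"
proof -
  show "Lx \<gamma> f \<in> polys_le (N - 1)" if "f \<in> polys_le N"
    using that
  proof (induction rule: polys_le_induct)
    case (monomial a)
    obtain \<alpha> \<beta> where a: "a = (\<alpha>, \<beta>)" by (cases a)
    show ?case unfolding a Lx_monomial
    proof (intro polys_le_sum)
      fix i
      show "(\<lambda>z. real (\<alpha> i) * (real (\<alpha> i) + \<gamma> $ i) * monomial_fun (\<alpha>(i := \<alpha> i - 1), \<beta>) z) \<in>
          polys_le (N - 1)"
      proof (cases "\<alpha> i > 0")
        case True
        then have "(\<alpha>(i := \<alpha> i - 1), \<beta>) \<in> multi_indices_le (N - 1)"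
          using monomial sum_dec[of \<alpha> i, OF True] sum_pos_of_pos[of \<alpha> i, OF True]
              by (auto simp: a multi_indices_le_def)
        then show ?thesis by (intro polys_le_cmult polys_le_monomial)
      qed (simp add: polys_le_zero)
    qed
  qed (auto simp: lin_plus[OF lin_Lx] lin_scale[OF lin_Lx] polys_le_polyfun intro: polys_le_add
      polys_le_cmult)
  show "Ly \<kappa> f \<in> polys_le (N - 1)" if "f \<in> polys_le N"
    using that
  proof (induction rule: polys_le_induct)
    case (monomial a)
    obtain \<alpha> \<beta> where a: "a = (\<alpha>, \<beta>)" by (cases a)
    show ?case unfolding a Ly_monomial
    proof (intro polys_le_sum)
      fix i
      show "(\<lambda>z. real (\<beta> i) * (real (\<beta> i) + \<kappa> $ Some i) * monomial_fun (\<alpha>, \<beta>(i := \<beta> i - 1)) z) \<in>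
          polys_le (N - 1)"
      proof (cases "\<beta> i > 0")
        case True
        then have "(\<alpha>, \<beta>(i := \<beta> i - 1)) \<in> multi_indices_le (N - 1)"
          using monomial sum_dec[of \<beta> i, OF True] sum_pos_of_pos[of \<beta> i, OF True]
              by (auto simp: a multi_indices_le_def)
        then show ?thesis by (intro polys_le_cmult polys_le_monomial)
      qed (simp add: polys_le_zero)
    qed
  qed (auto simp: lin_plus[OF lin_Ly] lin_scale[OF lin_Ly] polys_le_polyfun intro: polys_le_add
      polys_le_cmult)
  show "Lx \<gamma> f = (\<lambda>z. 0)" if "f \<in> polys_le 0"
    using that
  proof (induction rule: polys_le_induct)
    case (monomial a)
    then show ?case by (cases a) (auto simp: Lx_monomial multi_indices_le_def)
  qed (auto simp: lin_plus[OF lin_Lx] lin_scale[OF lin_Lx] polys_le_polyfun)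
qed

section \<open>The moment functional and the symmetry of the operator\<close>

definition lin_form :: "((('m::finite, 'n::finite) dom \<Rightarrow> real) \<Rightarrow> real) \<Rightarrow> bool" where
  "lin_form F \<longleftrightarrow>
     (\<forall>f g. polyfun f \<longrightarrow> polyfun g \<longrightarrow> F (\<lambda>z. f z + g z) = F f + F g) \<and>
     (\<forall>c f. polyfun f \<longrightarrow> F (\<lambda>z. c * f z) = c * F f)"

lemma lin_form_add: "lin_form F \<Longrightarrow> polyfun f \<Longrightarrow> polyfun g \<Longrightarrow> F (\<lambda>z. f z + g z) = F f + F g"
  and lin_form_cmult: "lin_form F \<Longrightarrow> polyfun f \<Longrightarrow> F (\<lambda>z. c * f z) = c * F f"
  by (auto simp: lin_form_def)

lemma lin_form_diff:
  assumes "lin_form F" "polyfun f" "polyfun g" shows "F (\<lambda>z. f z - g z) = F f - F g"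
  using lin_form_add[OF assms(1,2), of "\<lambda>z. (-1) * g z"] lin_form_cmult[OF assms(1,3), of "-1"]
      assms
  by (simp add: poly_intros)

lemma lin_form_sum:
  assumes "lin_form F" "\<And>i. polyfun (f i)"
  shows "F (\<lambda>z. \<Sum>i\<in>(S :: 'i::finite set). f i z) = (\<Sum>i\<in>S. F (f i))"
proof -
  have z: "F (\<lambda>z. 0) = 0"
    using lin_form_cmult[OF assms(1), of "\<lambda>z. 0" 0] by (simp add: poly_intros)
  show ?thesis
    using finite[of S]
  proof induction
    case (insert i S)
    then show ?case using assms
      by (simp add: lin_form_add[OF assms(1)] poly_intros)
  qed (simp add: z)
qed

lemma lin_form_minus: "lin_form F \<Longrightarrow> lin_form G \<Longrightarrow> lin_form (\<lambda>f. F f - G f)"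
  by (auto simp: lin_form_def algebra_simps)

lemma lin_form_comp: "lin_form F \<Longrightarrow> lin_op T \<Longrightarrow> lin_form (\<lambda>f. F (T f))"
  by (auto simp: lin_form_def lin_op_def)

lemma lin_form_ext:
  assumes "lin_form F" "\<And>\<alpha> \<beta>. F (monomial_fun (\<alpha>, \<beta>)) = 0" "polyfun f"
  shows "F f = 0"
  using assms(3)
proof (induction rule: poly_induct)
  case (monomial a)
  then show ?case using assms(2) by (cases a) simp
qed (simp_all add: lin_form_add[OF assms(1)] lin_form_cmult[OF assms(1)])

text \<open>All identities between bilinear expressions in two polynomials are proved by checking them
  on pairs of monomials.\<close>
lemma bilinear_ext:
  assumes "\<And>g. polyfun g \<Longrightarrow> lin_form (\<lambda>f. B f g)" "\<And>f. polyfun f \<Longrightarrow> lin_form (\<lambda>g. B f g)"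
    and "\<And>\<alpha> \<beta> \<alpha>' \<beta>'. B (monomial_fun (\<alpha>, \<beta>)) (monomial_fun (\<alpha>', \<beta>')) = 0"
    and "polyfun f" "polyfun g"
  shows "B f g = 0"
proof -
  have "B (monomial_fun (\<alpha>, \<beta>)) g = 0" for \<alpha> \<beta>
    using assms(2)[OF poly_monomial] assms(3) \<open>polyfun g\<close> by (rule lin_form_ext)
  with assms(1)[OF \<open>polyfun g\<close>] show ?thesis using \<open>polyfun f\<close> by (rule lin_form_ext)
qed

lemma monomial_mult:
  "monomial_fun (\<alpha>, \<beta>) z * monomial_fun (\<alpha>', \<beta>') z
      = monomial_fun (\<lambda>i. \<alpha> i + \<alpha>' i, \<lambda>j. \<beta> j + \<beta>' j) z"
  by (simp add: monomial_fun_def case_prod_beta power_add prod.distrib)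

lemma powr_times_power: "(x::real) \<ge> 0 \<Longrightarrow> x ^ n * x powr a = x powr (a + real n)"
  by (cases "x = 0") (auto simp: powr_add powr_realpow)

lemma powr_times_self: "(x::real) \<ge> 0 \<Longrightarrow> x * x powr a = x powr (a + 1)"
  using powr_times_power[of x 1 a] by simp

definition shift_x :: "real ^ 'm::finite \<Rightarrow> ('m \<Rightarrow> nat) \<Rightarrow> real ^ 'm" where
  "shift_x \<gamma> \<alpha> = (\<chi> i. \<gamma> $ i + real (\<alpha> i))"

definition shift_y :: "real ^ ('n::finite option) \<Rightarrow> ('n \<Rightarrow> nat) \<Rightarrow> real ^ ('n option)" where
  "shift_y \<kappa> \<beta> = (\<chi> j. case j of None \<Rightarrow> \<kappa> $ None | Some i \<Rightarrow> \<kappa> $ Some i + real (\<beta> i))"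

text \<open>This also holds on the boundary of the domain, since there both sides are zero.\<close>
lemma LT_weight_shift:
  assumes "z \<in> LT_domain"
  shows "monomial_fun (\<alpha>, \<beta>) z * LT_weight \<gamma> \<kappa> z = LT_weight (shift_x \<gamma> \<alpha>) (shift_y \<kappa> \<beta>) z"
proof -
  have x: "fst z $ i \<ge> 0" and y: "snd z $ j \<ge> 0" for i j
    using assms by (auto simp: LT_domain_def simplex_set_def)
  show ?thesis
    by (simp add: monomial_fun_def LT_weight_def case_prod_beta shift_x_def shift_y_def
        powr_times_power[OF x, symmetric] powr_times_power[OF y, symmetric] prod.distrib)
qed

lemma LT_weight_slack:
  assumes "z \<in> LT_domain"
  shows "slack z * LT_weight \<gamma> \<kappa> z = LT_weight \<gamma> (\<kappa> + axis None 1) z"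
proof -
  have "slack z \<ge> 0"
    using assms by (auto simp: LT_domain_def simplex_set_def slack_def)
  from powr_times_self[OF this, of "\<kappa> $ None"] show ?thesis
    by (simp add: LT_weight_def case_prod_beta slack_def axis_def)
qed

text \<open>The reason is the factorisation $a(a+w) - b(b+w) = (a-b)(a+b+w)$: the factor $a+b+w$ is
  exactly the one by which the lowered moment has to be multiplied to become a moment of the
  product, so only the difference of the degrees survives.\<close>
lemma antisymmetric_sum:
  fixes a b :: "'i::finite \<Rightarrow> nat" and w J :: "'i \<Rightarrow> real"
  assumes "\<And>i. a i + b i > 0 \<Longrightarrow> (real (a i + b i) + w i) * J i = M"
  shows "(\<Sum>i\<in>UNIV. real (a i) * (real (a i) + w i) * J i)
      - (\<Sum>i\<in>UNIV. real (b i) * (real (b i) + w i) * J i)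
     = (real (sum a UNIV) - real (sum b UNIV)) * M"
proof -
  have "real (a i) * (real (a i) + w i) * J i - real (b i) * (real (b i) + w i) * J i
      = (real (a i) - real (b i)) * M" for i
  proof (cases "a i + b i > 0")
    case True
    have "real (a i) * (real (a i) + w i) * J i - real (b i) * (real (b i) + w i) * J i
       = (real (a i) - real (b i)) * ((real (a i + b i) + w i) * J i)" by (simp add: algebra_simps)
    then show ?thesis unfolding assms[OF True] .
  qed auto
  then show ?thesis
    by (simp add: sum_subtractf[symmetric] sum_distrib_right[symmetric])
qed

locale laguerre_simplex =
  fixes \<gamma> :: "real ^ 'm::finite" and \<kappa> :: "real ^ ('n::finite option)"
  assumes \<gamma>: "\<forall>i. \<gamma> $ i > -1" and \<kappa>: "\<forall>j. \<kappa> $ j > -1"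
begin

definition I :: "(('m, 'n) dom \<Rightarrow> real) \<Rightarrow> real" where
  "I f = (LINT z:LT_domain|lborel. f z * LT_weight \<gamma> \<kappa> z)"

text \<open>The moment of $x^\alpha y^\beta$ contains two Gamma factors that depend on the exponents only
  through their sums: $\Gamma(A + |\alpha| + 1)$ in the numerator and
  $\Gamma(l + |\alpha| + |\beta| + 1)$ in the denominator.\<close>
definition A :: real where "A = \<kappa> $ None + entry_sum \<gamma> + real CARD('m)"
definition l :: real where "l = entry_sum \<kappa> + entry_sum \<gamma> + real CARD('m) + real CARD('n)"

lemma l_gt: "l > -1"
  using entry_sum_add_card_pos[OF \<gamma>] entry_sum_add_card_pos[OF \<kappa>] by (simp add: l_def)

lemma shift_x_gt: "\<forall>i. shift_x \<gamma> \<alpha> $ i > -1"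
proof
  fix i show "shift_x \<gamma> \<alpha> $ i > -1" using \<gamma>[rule_format, of i] by (simp add: shift_x_def)
qed

lemma shift_y_gt: "\<forall>j. shift_y \<kappa> \<beta> $ j > -1"
proof
  fix j show "shift_y \<kappa> \<beta> $ j > -1" using \<kappa>[rule_format, of j]
      by (cases j) (simp_all add: shift_y_def)
qed

lemma has_integral_weight:
  assumes "\<forall>i. g $ i > -1" "\<forall>j. k $ j > -1" "\<And>z. z \<in> LT_domain \<Longrightarrow> f z * LT_weight \<gamma> \<kappa> z
      = LT_weight g k z"
  shows "set_integrable lborel LT_domain (\<lambda>z. f z * LT_weight \<gamma> \<kappa> z)" "I f = LT_moment g k"
proof -
  have "has_bochner_integral lborel (\<lambda>z. indicator LT_domain z * LT_weight g k z) (LT_moment g k)"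
  proof (rule has_bochner_integral_nn_integral)
    show "(\<integral>\<^sup>+ z. ennreal (indicator LT_domain z * LT_weight g k z) \<partial>lborel)
        = ennreal (LT_moment g k)"
      by (rule nn_integral_LT_weight[OF assms(1,2)])
    have "0 < g $ i + 1" for i using assms(1)[rule_format, of i] by simp
    moreover have "0 < k $ Some j + 1" for j using assms(2)[rule_format, of "Some j"] by simp
    moreover have "0 < k $ None + entry_sum g + real CARD('m) + 1"
      using entry_sum_add_card_pos[OF assms(1)] assms(2)[rule_format, of None] by linarith
    moreover have "0 < entry_sum k + entry_sum g + real CARD('m) + real CARD('n) + 1"
      using entry_sum_add_card_pos[OF assms(1)] entry_sum_add_card_pos[OF assms(2)] by simp
    ultimately show "0 \<le> LT_moment g k"
      by (auto simp: LT_moment_def intro!: mult_nonneg_nonneg divide_nonneg_nonneg prod_nonneg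
          less_imp_le[OF Gamma_real_pos])
  qed (auto simp: LT_weight_nonneg)
  moreover have "(\<lambda>z. indicator LT_domain z * LT_weight g k z)
      = (\<lambda>z. indicator LT_domain z *\<^sub>R (f z * LT_weight \<gamma> \<kappa> z))"
    using assms(3) by (auto simp: indicator_def)
  ultimately show "set_integrable lborel LT_domain (\<lambda>z. f z * LT_weight \<gamma> \<kappa> z)" "I f
      = LT_moment g k"
    by (auto simp: set_integrable_def I_def set_lebesgue_integral_def has_bochner_integral_iff)
qed

lemma I_monomial: "I (monomial_fun (\<alpha>, \<beta>)) = LT_moment (shift_x \<gamma> \<alpha>) (shift_y \<kappa> \<beta>)"
  by (intro has_integral_weight shift_x_gt shift_y_gt LT_weight_shift)

lemma I_slack_monomial:
  "I (\<lambda>z. slack z * monomial_fun (\<alpha>, \<beta>) z) = LT_moment (shift_x \<gamma> \<alpha>) (shift_y \<kappa> \<beta> + axis None 1)"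
proof (intro has_integral_weight shift_x_gt)
  show "\<forall>j. (shift_y \<kappa> \<beta> + axis None 1) $ j > -1"
  proof
    fix j show "(shift_y \<kappa> \<beta> + axis None 1) $ j > -1"
      using shift_y_gt[of \<beta>, rule_format, of j] by (cases j) (simp_all add: axis_def)
  qed
qed (simp add: LT_weight_slack LT_weight_shift mult.assoc)

lemma integrable_polyfun:
  assumes "polyfun f"
  shows "set_integrable lborel LT_domain (\<lambda>z. f z * LT_weight \<gamma> \<kappa> z)"
  using assms
proof (induction rule: poly_induct)
  case (monomial a)
  obtain \<alpha> \<beta> where "a = (\<alpha>, \<beta>)" by (cases a)
  then show ?case
    using has_integral_weight(1)[OF shift_x_gt shift_y_gt LT_weight_shift, of \<alpha> \<beta>] by simp
qed (simp_all add: distrib_right mult.assoc set_integral_add set_integrable_mult_right)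

lemma lin_form_I: "lin_form I"
proof -
  have "I (\<lambda>z. f z + g z) = I f + I g" if "polyfun f" "polyfun g" for f g
    using set_integral_add(2)[OF that[THEN integrable_polyfun]] by (simp add: I_def distrib_right)
  moreover have "I (\<lambda>z. c * f z) = c * I f" for c f
    by (simp add: I_def mult.assoc)
  ultimately show ?thesis by (simp add: lin_form_def)
qed

lemma shift_x_dec: "\<alpha> i > 0 \<Longrightarrow> shift_x \<gamma> \<alpha> = shift_x \<gamma> (\<alpha>(i := \<alpha> i - 1)) + axis i 1"
  by (auto simp: shift_x_def vec_eq_iff axis_def of_nat_diff)

lemma shift_y_dec: "\<beta> j > 0 \<Longrightarrow> shift_y \<kappa> \<beta> = shift_y \<kappa> (\<beta>(j := \<beta> j - 1)) + axis (Some j) 1"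
  by (auto simp: shift_y_def vec_eq_iff axis_def of_nat_diff split: option.splits)

lemma entry_sum_shift_x: "entry_sum (shift_x \<gamma> \<alpha>) = entry_sum \<gamma> + real (sum \<alpha> UNIV)"
  by (simp add: entry_sum_def shift_x_def sum.distrib)

lemma entry_sum_shift_y: "entry_sum (shift_y \<kappa> \<beta>) = entry_sum \<kappa> + real (sum \<beta> UNIV)"
  by (simp add: entry_sum_option shift_y_def sum.distrib)

text \<open>In terms of integrals: integrating $\partial_{x_i}$ of $x^c e^{-|x|/s}\,x^\gamma$ over a fibre
  $y = const$ gives zero.\<close>
lemma moment_x_slack:
  assumes "c i > 0"
  shows "(real (c i) + \<gamma> $ i) * I (\<lambda>z. slack z * monomial_fun (c(i := c i - 1), \<delta>) z)
      = I (monomial_fun (c, \<delta>))"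
proof -
  have "shift_x \<gamma> (c(i := c i - 1)) $ i + 1 = real (c i) + \<gamma> $ i"
    using assms by (simp add: shift_x_def of_nat_diff)
  then show ?thesis
    using LT_moment_axis(1)[OF shift_x_gt[of "c(i := c i - 1)"] shift_y_gt[of \<delta>], of i]
    by (simp only: I_slack_monomial I_monomial shift_x_dec[of c i, OF assms])
qed

lemma slack_moment:
  "(real (sum c UNIV + sum \<delta> UNIV) + l + 1) * I (\<lambda>z. slack z * monomial_fun (c, \<delta>) z)
     = (A + real (sum c UNIV) + 1) * I (monomial_fun (c, \<delta>))"
proof -
  have "shift_y \<kappa> \<delta> $ None + entry_sum (shift_x \<gamma> c) + real CARD('m) = A + real (sum c UNIV)"
    by (simp add: entry_sum_shift_x A_def shift_y_def)
  moreover have "entry_sum (shift_y \<kappa> \<delta>) + entry_sum (shift_x \<gamma> c) + real CARD('m) + real CARD('n)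
      = real (sum c UNIV + sum \<delta> UNIV) + l"
    by (simp add: entry_sum_shift_x entry_sum_shift_y l_def)
  ultimately show ?thesis
    using LT_moment_axis(2)[OF shift_x_gt[of c] shift_y_gt[of \<delta>]]
    by (simp only: I_slack_monomial I_monomial)
qed

lemma moment_x:
  assumes "c i > 0"
  shows "(A + real (sum c UNIV)) * (real (c i) + \<gamma> $ i) * I (monomial_fun (c(i := c i - 1), \<delta>))
     = (real (sum c UNIV + sum \<delta> UNIV) + l) * I (monomial_fun (c, \<delta>))"
proof -
  have s: "real (\<Sum>k\<in>UNIV. (c(i := c i - 1)) k) = real (sum c UNIV) - 1"
    using sum_dec[of c i, OF assms] sum_pos_of_pos[of c i, OF assms]
        by (simp only: of_nat_diff of_nat_1)
  have e: "real (\<Sum>k\<in>UNIV. (c(i := c i - 1)) k) + real (sum \<delta> UNIV) + l + 1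
      = real (sum c UNIV) + real (sum \<delta> UNIV) + l"
     "A + real (\<Sum>k\<in>UNIV. (c(i := c i - 1)) k) + 1 = A + real (sum c UNIV)"
    unfolding s by simp_all
  note h1 = slack_moment[of "c(i := c i - 1)" \<delta>, unfolded of_nat_add e]
  note h2 = moment_x_slack[of c i, OF assms, of \<delta>]
  have "(A + real (sum c UNIV)) * (real (c i) + \<gamma> $ i) * I (monomial_fun (c(i := c i - 1), \<delta>))
      = (real (c i) + \<gamma> $ i) * ((A + real (sum c UNIV)) * I (monomial_fun (c(i := c i - 1), \<delta>)))"
    by (simp only: mult_ac)
  also have "\<dots> = (real (sum c UNIV) + real (sum \<delta> UNIV) + l) *
      ((real (c i) + \<gamma> $ i) * I (\<lambda>z. slack z * monomial_fun (c(i := c i - 1), \<delta>) z))"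
    unfolding h1[symmetric] by (simp only: mult_ac)
  finally show ?thesis unfolding h2 of_nat_add .
qed

lemma moment_y:
  assumes "\<delta> j > 0"
  shows "(real (\<delta> j) + \<kappa> $ Some j) * I (monomial_fun (c, \<delta>(j := \<delta> j - 1)))
     = (real (sum c UNIV + sum \<delta> UNIV) + l) * I (monomial_fun (c, \<delta>))"
proof -
  have s: "real (\<Sum>k\<in>UNIV. (\<delta>(j := \<delta> j - 1)) k) = real (sum \<delta> UNIV) - 1"
    using sum_dec[of \<delta> j, OF assms] sum_pos_of_pos[of \<delta> j, OF assms]
        by (simp only: of_nat_diff of_nat_1)
  have 1: "entry_sum (shift_y \<kappa> (\<delta>(j := \<delta> j - 1))) + entry_sum (shift_x \<gamma> c) + real CARD('m)
      + real CARD('n) + 1 = real (sum c UNIV + sum \<delta> UNIV) + l"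
    unfolding entry_sum_shift_x entry_sum_shift_y s by (simp add: l_def)
  have 2: "shift_y \<kappa> (\<delta>(j := \<delta> j - 1)) $ Some j + 1 = real (\<delta> j) + \<kappa> $ Some j"
    using assms by (simp add: shift_y_def of_nat_diff)
  show ?thesis
    using LT_moment_axis(3)[OF shift_x_gt[of c] shift_y_gt[of "\<delta>(j := \<delta> j - 1)"], of j]
    unfolding 1 2 by (simp only: I_monomial shift_y_dec[of \<delta> j, OF assms])
qed

lemma fun_add_dec:
  "a i > (0::nat) \<Longrightarrow> (\<lambda>k. (a(i := a i - 1)) k + b k) = (\<lambda>k. a k + b k)(i := a i + b i - 1)"
  by auto

text \<open>A monomial of $L f \cdot g$ is the product $f g$ with one exponent lowered, and so depends on
  the exponents of $f$ and $g$ only through their sum; exchanging $f$ and $g$ changes the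
  coefficients but not the moments. The factor \<open>h\<close> is $1$ or $s$ in the applications.\<close>
lemma I_linear_combination_x:
  fixes h :: "('m, 'n) dom \<Rightarrow> real"
  assumes "polyfun h"
  shows "I (\<lambda>z. h z * Lx \<gamma> (monomial_fun (a, \<beta>)) z * monomial_fun (b, \<beta>') z)
    = (\<Sum>i\<in>UNIV. real (a i) * (real (a i) + \<gamma> $ i) *
        I (\<lambda>z. h z * monomial_fun ((\<lambda>k. a k + b k)(i := a i + b i - 1), \<lambda>k. \<beta> k + \<beta>' k) z))"
proof -
  let ?m = "\<lambda>i. monomial_fun ((\<lambda>k. a k + b k)(i := a i + b i - 1), \<lambda>k. \<beta> k + \<beta>' k)"
  have "(\<lambda>z. h z * Lx \<gamma> (monomial_fun (a, \<beta>)) z * monomial_fun (b, \<beta>') z)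
      = (\<lambda>z. \<Sum>i\<in>UNIV. real (a i) * (real (a i) + \<gamma> $ i) * (h z * ?m i z))"
  proof
    fix z
    have "real (a i) * (real (a i) + \<gamma> $ i) *
        (h z * (monomial_fun (a(i := a i - 1), \<beta>) z * monomial_fun (b, \<beta>') z))
        = real (a i) * (real (a i) + \<gamma> $ i) * (h z * ?m i z)" for i
      unfolding monomial_mult by (cases "a i > 0") (simp_all only: fun_add_dec, simp)
    then show "h z * Lx \<gamma> (monomial_fun (a, \<beta>)) z * monomial_fun (b, \<beta>') z
      = (\<Sum>i\<in>UNIV. real (a i) * (real (a i) + \<gamma> $ i) * (h z * ?m i z))"
      by (simp only: Lx_monomial sum_distrib_left sum_distrib_right mult_ac)
  qed
  then show ?thesis
    using assms by (simp only: lin_form_sum[OF lin_form_I] lin_form_cmult[OF lin_form_I]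
        poly_intros poly_monomial)
qed

lemma I_linear_combination_y:
  "I (\<lambda>z. Ly \<kappa> (monomial_fun (a, \<beta>)) z * monomial_fun (b, \<beta>') z)
    = (\<Sum>j\<in>UNIV. real (\<beta> j) * (real (\<beta> j) + \<kappa> $ Some j) *
        I (monomial_fun (\<lambda>k. a k + b k, (\<lambda>k. \<beta> k + \<beta>' k)(j := \<beta> j + \<beta>' j - 1))))"
proof -
  let ?m = "\<lambda>j. monomial_fun (\<lambda>k. a k + b k, (\<lambda>k. \<beta> k + \<beta>' k)(j := \<beta> j + \<beta>' j - 1))"
  have "(\<lambda>z. Ly \<kappa> (monomial_fun (a, \<beta>)) z * monomial_fun (b, \<beta>') z)
      = (\<lambda>z. \<Sum>j\<in>UNIV. real (\<beta> j) * (real (\<beta> j) + \<kappa> $ Some j) * ?m j z)"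
  proof
    fix z
    have "real (\<beta> j) * (real (\<beta> j) + \<kappa> $ Some j)
        * (monomial_fun (a, \<beta>(j := \<beta> j - 1)) z * monomial_fun (b, \<beta>') z)
        = real (\<beta> j) * (real (\<beta> j) + \<kappa> $ Some j) * ?m j z" for j
      unfolding monomial_mult by (cases "\<beta> j > 0") (simp_all only: fun_add_dec, simp)
    then show "Ly \<kappa> (monomial_fun (a, \<beta>)) z * monomial_fun (b, \<beta>') z
      = (\<Sum>j\<in>UNIV. real (\<beta> j) * (real (\<beta> j) + \<kappa> $ Some j) * ?m j z)"
      by (simp only: Ly_monomial sum_distrib_left sum_distrib_right mult_ac)
  qed
  then show ?thesis
    by (simp only: lin_form_sum[OF lin_form_I] lin_form_cmult[OF lin_form_I] poly_intros
        poly_monomial)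
qed

lemma slack_Lx_symmetric_monomial:
  fixes f g :: "('m, 'n) dom \<Rightarrow> real"
  assumes f: "f = monomial_fun (a, \<beta>)" and g: "g = monomial_fun (b, \<beta>')"
  shows "I (\<lambda>z. slack z * Lx \<gamma> f z * g z) - I (\<lambda>z. slack z * Lx \<gamma> g z * f z)
    = I (\<lambda>z. eulerx f z * g z) - I (\<lambda>z. eulerx g z * f z)"
proof -
  let ?c = "\<lambda>k. a k + b k" and ?d = "\<lambda>k. \<beta> k + \<beta>' k"
  let ?J = "\<lambda>i. I (\<lambda>z. slack z * monomial_fun (?c(i := a i + b i - 1), ?d) z)"
  have J: "(real (a i + b i) + \<gamma> $ i) * ?J i = I (monomial_fun (?c, ?d))" if "a i + b i > 0" for i
    using moment_x_slack[of ?c i ?d] that by simp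
  have 1: "I (\<lambda>z. slack z * Lx \<gamma> f z * g z) = (\<Sum>i\<in>UNIV. real (a i) * (real (a i) + \<gamma> $ i) * ?J i)"
    unfolding f g by (rule I_linear_combination_x) simp
  have 2: "I (\<lambda>z. slack z * Lx \<gamma> g z * f z) = (\<Sum>i\<in>UNIV. real (b i) * (real (b i) + \<gamma> $ i) * ?J i)"
    unfolding f g using I_linear_combination_x[OF poly_slack, of b \<beta>' a \<beta>]
    by (simp only: add.commute[of "b k" "a k" for k] add.commute[of "\<beta>' k" "\<beta> k" for k])
  have 3: "I (\<lambda>z. eulerx f z * g z) = real (sum a UNIV) * I (monomial_fun (?c, ?d))"
    unfolding f g eulerx_monomial mult.assoc monomial_mult
    by (rule lin_form_cmult[OF lin_form_I]) simp
  have 4: "I (\<lambda>z. eulerx g z * f z) = real (sum b UNIV) * I (monomial_fun (?c, ?d))"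
    unfolding f g eulerx_monomial mult.assoc monomial_mult
      add.commute[of "b k" "a k" for k] add.commute[of "\<beta>' k" "\<beta> k" for k]
    by (rule lin_form_cmult[OF lin_form_I]) simp
  show ?thesis
    unfolding 1 2 3 4 left_diff_distrib[symmetric] by (rule antisymmetric_sum) (rule J)
qed

text \<open>This is the symmetry of the fibrewise Laguerre operator $sL - E$. It holds for all
  polynomials, and so may be applied to $Lf$.\<close>
lemma slack_Lx_symmetric:
  assumes "polyfun f" "polyfun g"
  shows "I (\<lambda>z. slack z * Lx \<gamma> f z * g z) - I (\<lambda>z. slack z * Lx \<gamma> g z * f z)
    = I (\<lambda>z. eulerx f z * g z) - I (\<lambda>z. eulerx g z * f z)"
proof -
  have "(I (\<lambda>z. slack z * Lx \<gamma> f z * g z) - I (\<lambda>z. slack z * Lx \<gamma> g z * f z))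
    - (I (\<lambda>z. eulerx f z * g z) - I (\<lambda>z. eulerx g z * f z)) = 0" (is "?B f g = 0")
  proof (rule bilinear_ext[where B = ?B])
    show "lin_form (\<lambda>f. ?B f g)" if "polyfun g" for g
      by (intro lin_form_minus lin_form_comp[OF lin_form_I] lin_mult_right[OF that]
          lin_mult_left[OF poly_slack] lin_Lx lin_eulerx)
         (intro lin_mult_left lin_id real_polynomial_function.intros(4) poly_slack
             lin_poly[OF lin_Lx that] lin_poly[OF lin_eulerx that])+
    show "lin_form (\<lambda>g. ?B f g)" if "polyfun f" for f
      by (intro lin_form_minus lin_form_comp[OF lin_form_I] lin_mult_right[OF that]
          lin_mult_left[OF poly_slack] lin_Lx lin_eulerx)
         (intro lin_mult_left lin_id real_polynomial_function.intros(4) poly_slack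
             lin_poly[OF lin_Lx that] lin_poly[OF lin_eulerx that])+
    show "?B (monomial_fun (a, \<beta>)) (monomial_fun (b, \<beta>')) = 0" for a \<beta> b \<beta>'
      using slack_Lx_symmetric_monomial[OF refl refl, of a \<beta> b \<beta>'] by simp
  qed (use assms in auto)
  then show ?thesis by simp
qed

lemma Lx_antisymmetric:
  fixes f g :: "('m, 'n) dom \<Rightarrow> real"
  assumes f: "f = monomial_fun (a, \<beta>)" and g: "g = monomial_fun (b, \<beta>')"
  shows "(A + real (sum a UNIV) + real (sum b UNIV))
      * (I (\<lambda>z. Lx \<gamma> f z * g z) - I (\<lambda>z. Lx \<gamma> g z * f z))
    = (real (sum a UNIV) - real (sum b UNIV)) *
      ((real (sum a UNIV + sum \<beta> UNIV) + real (sum b UNIV + sum \<beta>' UNIV) + l) * I (\<lambda>z. f z * g z))"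
proof -
  let ?c = "\<lambda>k. a k + b k" and ?d = "\<lambda>k. \<beta> k + \<beta>' k"
  define K where "K = A + real (sum a UNIV) + real (sum b UNIV)"
  have pull: "(\<Sum>i\<in>UNIV. x i * (K * y i)) = K * (\<Sum>i\<in>UNIV. x i * y i)" for x y :: "'m \<Rightarrow> real"
    by (simp add: sum_distrib_left mult.left_commute)
  let ?J = "\<lambda>i. I (monomial_fun (?c(i := a i + b i - 1), ?d))"
  have J: "(real (a i + b i) + \<gamma> $ i) * (K * ?J i)
      = (real (sum a UNIV + sum \<beta> UNIV) + real (sum b UNIV + sum \<beta>' UNIV) + l)
          * I (monomial_fun (?c, ?d))" if "a i + b i > 0" for i
    using moment_x[of ?c i ?d] that by (simp add: sum.distrib algebra_simps K_def)
  have 1: "I (\<lambda>z. Lx \<gamma> f z * g z) = (\<Sum>i\<in>UNIV. real (a i) * (real (a i) + \<gamma> $ i) * ?J i)"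
    unfolding f g using I_linear_combination_x[of "\<lambda>z. 1" a \<beta> b \<beta>'] by (simp add: poly_intros)
  have 2: "I (\<lambda>z. Lx \<gamma> g z * f z) = (\<Sum>i\<in>UNIV. real (b i) * (real (b i) + \<gamma> $ i) * ?J i)"
    unfolding f g using I_linear_combination_x[of "\<lambda>z. 1", of b \<beta>' a \<beta>]
    by (simp only: mult_1 add.commute[of "b k" "a k" for k] add.commute[of "\<beta>' k" "\<beta> k" for k]
        real_polynomial_function.intros(2))
  have 3: "I (\<lambda>z. f z * g z) = I (monomial_fun (?c, ?d))"
    unfolding f g monomial_mult ..
  show ?thesis
    unfolding 1 2 3 K_def[symmetric] right_diff_distrib[of K] pull[symmetric]
    by (rule antisymmetric_sum) (rule J)
qed

lemma Ly_antisymmetric: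
  fixes f g :: "('m, 'n) dom \<Rightarrow> real"
  assumes f: "f = monomial_fun (a, \<beta>)" and g: "g = monomial_fun (b, \<beta>')"
  shows "I (\<lambda>z. Ly \<kappa> f z * g z) - I (\<lambda>z. Ly \<kappa> g z * f z)
    = (real (sum \<beta> UNIV) - real (sum \<beta>' UNIV)) *
      ((real (sum a UNIV + sum \<beta> UNIV) + real (sum b UNIV + sum \<beta>' UNIV) + l) * I (\<lambda>z. f z * g z))"
proof -
  let ?c = "\<lambda>k. a k + b k" and ?d = "\<lambda>k. \<beta> k + \<beta>' k"
  let ?J = "\<lambda>j. I (monomial_fun (?c, ?d(j := \<beta> j + \<beta>' j - 1)))"
  have J: "(real (\<beta> j + \<beta>' j) + \<kappa> $ Some j) * ?J j
      = (real (sum a UNIV + sum \<beta> UNIV) + real (sum b UNIV + sum \<beta>' UNIV) + l)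
          * I (monomial_fun (?c, ?d))" if "\<beta> j + \<beta>' j > 0" for j
    using moment_y[of ?d j ?c] that by (simp add: sum.distrib algebra_simps)
  have 2: "I (\<lambda>z. Ly \<kappa> g z * f z) = (\<Sum>j\<in>UNIV. real (\<beta>' j) * (real (\<beta>' j) + \<kappa> $ Some j) * ?J j)"
    unfolding f g I_linear_combination_y
    by (simp only: add.commute[of "b k" "a k" for k] add.commute[of "\<beta>' k" "\<beta> k" for k])
  have 3: "I (\<lambda>z. f z * g z) = I (monomial_fun (?c, ?d))"
    unfolding f g monomial_mult ..
  show ?thesis
    unfolding 2 3 unfolding f g I_linear_combination_y
    by (rule antisymmetric_sum) (rule J)
qed

text \<open>With $p$ the degree of $f$, the first coefficient arises as
  $(2|a|-1+A) - (|a|-1-|b|)$: the first bracket collects $LE + EL + AL$, as $Lf$ has $x$-degree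
  $|a|-1$, and the second comes from moving $sL$ in $s\,L(Lf)\cdot g$ over to $g$. The resulting
  factor $A+|a|+|b|$ is symmetric in $f$ and $g$.\<close>
lemma I_LT_operator_monomial:
  fixes f g :: "('m, 'n) dom \<Rightarrow> real"
  assumes f: "f = monomial_fun (a, \<beta>)" and g: "g = monomial_fun (b, \<beta>')"
  defines "p \<equiv> real (sum a UNIV + sum \<beta> UNIV)"
  shows "I (\<lambda>z. LT_operator \<gamma> \<kappa> f z * g z) =
    (A + real (sum a UNIV) + real (sum b UNIV)) * I (\<lambda>z. Lx \<gamma> f z * g z)
    - I (\<lambda>z. slack z * Lx \<gamma> f z * Lx \<gamma> g z) + I (\<lambda>z. Ly \<kappa> f z * g z)
        - p * (p + l) * I (\<lambda>z. f z * g z)"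
proof -
  let ?a = "real (sum a UNIV)" and ?b = "real (sum b UNIV)"
  have pf: "polyfun f" and pg: "polyfun g" by (simp_all add: f g)
  have pL: "polyfun (Lx \<gamma> f)" and pLL: "polyfun (Lx \<gamma> (Lx \<gamma> f))" and pY: "polyfun (Ly \<kappa> f)"
    using pf by (simp_all add: lin_poly[OF lin_Lx] lin_poly[OF lin_Ly])
  have e1: "Lx \<gamma> (eulerx f) = (\<lambda>z. ?a * Lx \<gamma> f z)"
    unfolding f eulerx_monomial by (rule lin_scale[OF lin_Lx poly_monomial])
  have e2: "eulerx (Lx \<gamma> f) = (\<lambda>z. (?a - 1) * Lx \<gamma> f z)"
    unfolding f by (rule eulerx_Lx_monomial)
  have e3: "euler f = (\<lambda>z. p * f z)"
    unfolding f euler_monomial p_def ..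
  have e4: "euler (\<lambda>z. p * f z) = (\<lambda>z. p * (p * f z))"
    unfolding lin_scale[OF lin_euler pf] e3 ..
  have e5: "eulerx g = (\<lambda>z. ?b * g z)"
    unfolding g by (rule eulerx_monomial)
  have "LT_operator \<gamma> \<kappa> f z * g z = (2 * ?a - 1 + A) * (Lx \<gamma> f z * g z)
      - slack z * Lx \<gamma> (Lx \<gamma> f) z * g z
      + Ly \<kappa> f z * g z - (p * (p + l)) * (f z * g z)" for z
    unfolding LT_operator_alt e1 e2 e3 e4 A_def l_def by (simp add: algebra_simps)
  then have "I (\<lambda>z. LT_operator \<gamma> \<kappa> f z * g z)
      = (2 * ?a - 1 + A) * I (\<lambda>z. Lx \<gamma> f z * g z) - I (\<lambda>z. slack z * Lx \<gamma> (Lx \<gamma> f) z * g z)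
      + I (\<lambda>z. Ly \<kappa> f z * g z) - (p * (p + l)) * I (\<lambda>z. f z * g z)"
    by (simp add: lin_form_add[OF lin_form_I] lin_form_diff[OF lin_form_I]
        lin_form_cmult[OF lin_form_I]
        real_polynomial_function.intros(2-4) real_polynomial_function_diff pf pg pL pLL pY)
  moreover have "I (\<lambda>z. slack z * Lx \<gamma> (Lx \<gamma> f) z * g z) - I (\<lambda>z. slack z * Lx \<gamma> g z * Lx \<gamma> f z)
      = (?a - 1) * I (\<lambda>z. Lx \<gamma> f z * g z) - ?b * I (\<lambda>z. Lx \<gamma> f z * g z)"
    unfolding slack_Lx_symmetric[OF pL pg] e2 e5
    using lin_form_cmult[OF lin_form_I real_polynomial_function.intros(4)[OF pL pg]]
    by (simp add: mult.assoc mult.commute[of "g z" "Lx \<gamma> f z" for z])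
  moreover have "I (\<lambda>z. slack z * Lx \<gamma> g z * Lx \<gamma> f z) = I (\<lambda>z. slack z * Lx \<gamma> f z * Lx \<gamma> g z)"
    by (simp only: mult_ac)
  ultimately show ?thesis by (simp add: algebra_simps)
qed

text \<open>The antisymmetric parts of the terms in $L$ and $L^{(y)}$ add up to
  $(p-q)(p+q+l)\,I(fg)$ for monomials of degrees $p$ and $q$, which is
  $\big(p(p+l)-q(q+l)\big)I(fg)$.\<close>
lemma LT_operator_symmetric:
  assumes "polyfun f" "polyfun g"
  shows "I (\<lambda>z. LT_operator \<gamma> \<kappa> f z * g z) = I (\<lambda>z. LT_operator \<gamma> \<kappa> g z * f z)"
proof -
  have "I (\<lambda>z. LT_operator \<gamma> \<kappa> f z * g z) - I (\<lambda>z. LT_operator \<gamma> \<kappa> g z * f z) = 0" (is "?B f g = 0")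
  proof (rule bilinear_ext[where B = ?B])
    show "lin_form (\<lambda>f. ?B f g)" if "polyfun g" for g
      by (intro lin_form_minus lin_form_comp[OF lin_form_I] lin_mult_right[OF that] lin_LT_operator
          lin_mult_left[OF lin_poly[OF lin_LT_operator that]] lin_id)
    show "lin_form (\<lambda>g. ?B f g)" if "polyfun f" for f
      by (intro lin_form_minus lin_form_comp[OF lin_form_I] lin_mult_right[OF that] lin_LT_operator
          lin_mult_left[OF lin_poly[OF lin_LT_operator that]] lin_id)
    fix a \<beta> b \<beta>'
    define f where "f = (monomial_fun (a, \<beta>) :: ('m, 'n) dom \<Rightarrow> real)"
    define g where "g = (monomial_fun (b, \<beta>') :: ('m, 'n) dom \<Rightarrow> real)"
    have s: "I (\<lambda>z. slack z * Lx \<gamma> g z * Lx \<gamma> f z) = I (\<lambda>z. slack z * Lx \<gamma> f z * Lx \<gamma> g z)"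
        "I (\<lambda>z. g z * f z) = I (\<lambda>z. f z * g z)"
      by (simp_all only: mult_ac)
    have "?B f g = 0"
      using Lx_antisymmetric[OF f_def g_def] Ly_antisymmetric[OF f_def g_def]
      unfolding I_LT_operator_monomial[OF f_def g_def] I_LT_operator_monomial[OF g_def f_def] s
          of_nat_add
      by algebra
    then show "?B (monomial_fun (a, \<beta>)) (monomial_fun (b, \<beta>')) = 0" by (simp add: f_def g_def)
  qed (use assms in auto)
  then show ?thesis by simp
qed

end

section \<open>Triangularity, positivity and the eigenspaces\<close>

text \<open>On each line through a point of \<open>U\<close> the polynomial has infinitely many zeros.\<close>
lemma zero_polynomial_if_zero_on_open:
  fixes w :: "'a::euclidean_space \<Rightarrow> real"
  assumes w: "polyfun w" and U: "open U" "z0 \<in> U" "\<And>z. z \<in> U \<Longrightarrow> w z = 0"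
  shows "w z = 0"
proof -
  define v where "v = z - z0"
  have "polynomial_function (\<lambda>t::real. z0 + t *\<^sub>R v)"
    by (intro polynomial_function_add polynomial_function_const polynomial_function_bounded_linear
        bounded_linear_scaleR_left)
  from real_polynomial_function_compose[OF this w]
  have "polyfun (\<lambda>t. w (z0 + t *\<^sub>R v))" by (simp add: o_def)
  then obtain c n where c: "\<And>t. w (z0 + t *\<^sub>R v) = (\<Sum>i\<le>n. c i * t ^ i)"
    unfolding real_polynomial_function_iff_sum by metis
  have "open ((\<lambda>t::real. z0 + t *\<^sub>R v) -` U)"
    by (intro open_vimage U continuous_intros)
  moreover have "(0::real) \<in> (\<lambda>t. z0 + t *\<^sub>R v) -` U" using U by simp
  ultimately have "infinite ((\<lambda>t::real. z0 + t *\<^sub>R v) -` U)"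
    by (metis empty_iff finite_imp_not_open)
  moreover have "(\<lambda>t::real. z0 + t *\<^sub>R v) -` U \<subseteq> {t. (\<Sum>i\<le>n. c i * t ^ i) = 0}"
    using U(3) by (auto simp flip: c)
  ultimately have "infinite {t. (\<Sum>i\<le>n. c i * t ^ i) = 0}" using infinite_super by blast
  then have "\<forall>i\<le>n. c i = 0" unfolding polyfun_finite_roots by blast
  then have "w (z0 + 1 *\<^sub>R v) = 0" unfolding c by simp
  then show ?thesis by (simp add: v_def)
qed

context laguerre_simplex
begin

text \<open>$L$ and $L^{(y)}$ lower the degree by one, and $s\,L^2$ does so as well, because the factor
  $s$ gives back only one of the two degrees lost. Hence the diagonal part comes from the Euler
  operator alone.\<close>
lemma LT_operator_triangular:
  assumes "f \<in> polys_le N"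
  shows "(\<lambda>z. LT_operator \<gamma> \<kappa> f z + real N * (real N + l) * f z) \<in> polys_le (N - 1)"
  using assms
proof (induction rule: polys_le_induct)
  case (monomial a)
  obtain \<alpha> \<beta> where a: "a = (\<alpha>, \<beta>)" by (cases a)
  let ?f = "monomial_fun a :: ('m, 'n) dom \<Rightarrow> real"
  define p where "p = sum \<alpha> UNIV + sum \<beta> UNIV"
  have f: "?f \<in> polys_le N" using monomial by (rule polys_le_monomial)
  have e3: "euler ?f = (\<lambda>z. real p * ?f z)"
    unfolding a euler_monomial p_def ..
  have e4: "euler (\<lambda>z. real p * ?f z) = (\<lambda>z. real p * (real p * ?f z))"
    unfolding lin_scale[OF lin_euler poly_monomial] e3 ..
  have q: "(\<lambda>z. slack z * Lx \<gamma> (Lx \<gamma> ?f) z) \<in> polys_le (N - 1)"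
  (* for N at most 1 the degree count fails by truncation, but then Lx maps into the constants *)
  proof (cases "N \<le> 1")
    case True
    then have "Lx \<gamma> ?f \<in> polys_le 0" using Lx_polys_le[OF f, of \<gamma>] by simp
    then show ?thesis by (simp add: Lx_polys_le_0 polys_le_zero)
  next
    case False
    then have "1 + (N - 1 - 1) = N - 1" by simp
    with polys_le_mult[OF slack_polys_le Lx_polys_le[OF Lx_polys_le[OF f]], of \<gamma> \<gamma>]
    show ?thesis by (simp only:)
  qed
  have diag: "(\<lambda>z. (real N * (real N + l) - real p * (real p + l)) * ?f z) \<in> polys_le (N - 1)"
  proof (cases "p = N")
    case False
    then have "a \<in> multi_indices_le (N - 1)"
      using monomial by (auto simp: a p_def multi_indices_le_def)
    then show ?thesis by (intro polys_le_cmult polys_le_monomial)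
  qed (simp add: polys_le_zero)
  have "(\<lambda>z. (Lx \<gamma> (eulerx ?f) z + eulerx (Lx \<gamma> ?f) z - slack z * Lx \<gamma> (Lx \<gamma> ?f) z + A * Lx \<gamma> ?f z
      + Ly \<kappa> ?f z)
     + (real N * (real N + l) - real p * (real p + l)) * ?f z) \<in> polys_le (N - 1)"
    by (intro polys_le_add[OF _ diag]) (intro polys_le_add polys_le_diff q polys_le_cmult
        Lx_polys_le Ly_polys_le eulerx_polys_le f)
  then show ?case
    unfolding LT_operator_alt e3 e4 by (simp add: A_def l_def algebra_simps)
next
  case (add f g)
  then show ?case
    using polys_le_add[OF add.IH] by (simp add: lin_plus[OF lin_LT_operator] polys_le_polyfun
        algebra_simps)
next
  case (cmult c f)
  then show ?case
    using polys_le_cmult[OF cmult.IH, of c] by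
        (simp add: lin_scale[OF lin_LT_operator] polys_le_polyfun algebra_simps)
qed

definition ev :: "nat \<Rightarrow> real" where "ev k = - real k * (real k + l)"

text \<open>The remainder vanishes for degree 0, which truncated subtraction cannot express by
  membership in \<open>polys_le (N - 1)\<close> alone.\<close>
lemma LT_operator_eigenvalue_plus_lower:
  assumes "f \<in> polys_le N"
  shows "\<exists>g. (\<forall>z. LT_operator \<gamma> \<kappa> f z = ev N * f z + g z) \<and>
     (if N = 0 then g = (\<lambda>z. 0) else g \<in> polys_le (N - 1))"
proof (cases "N = 0")
  case True
  then obtain c where "f = (\<lambda>z. c)" using polys_le_0_const assms by blast
  with True show ?thesis by (auto simp: LT_operator_const ev_def)
next
  case False
  then show ?thesis using LT_operator_triangular[OF assms]
    by (intro exI[of _ "\<lambda>z. LT_operator \<gamma> \<kappa> f z + real N * (real N + l) * f z"]) (simp add: ev_def)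
qed

lemma ev_inj: "m \<noteq> k \<Longrightarrow> ev m \<noteq> ev k"
proof -
  assume "m \<noteq> k"
  then have "real m + real k + l > 0" using l_gt by (cases "m = 0") linarith+
  moreover have "ev k - ev m = (real m - real k) * (real m + real k + l)"
      by (simp add: ev_def algebra_simps)
  ultimately show ?thesis using \<open>m \<noteq> k\<close> by auto
qed

text \<open>A triangular operator with nonzero diagonal is inverted by eliminating the top degree
  repeatedly.\<close>
lemma ex_resolvent:
  assumes "q \<in> polys_le N" "N < n"
  shows "\<exists>r. polyfun r \<and> (\<forall>z. LT_operator \<gamma> \<kappa> r z - ev n * r z = q z)"
  using assms
proof (induction N arbitrary: q rule: less_induct)
  case (less N)
  define r0 where "r0 = (\<lambda>z. (1 / (ev N - ev n)) * q z)"
  have ne: "ev N - ev n \<noteq> 0" using ev_inj less.prems by simp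
  have r0: "r0 \<in> polys_le N" unfolding r0_def by (rule polys_le_cmult) fact
  then have p0: "polyfun r0" by (rule polys_le_polyfun)
  obtain g where g: "\<And>z. LT_operator \<gamma> \<kappa> r0 z = ev N * r0 z + g z"
    "if N = 0 then g = (\<lambda>z. 0) else g \<in> polys_le (N - 1)"
    using LT_operator_eigenvalue_plus_lower[OF r0] by metis
  have eq: "LT_operator \<gamma> \<kappa> r0 z - ev n * r0 z = q z + g z" for z
  proof -
    have "(ev N - ev n) * r0 z = q z" using ne by (simp add: r0_def)
    then show ?thesis unfolding g(1) by (simp add: left_diff_distrib)
  qed
  show ?case
  proof (cases "N = 0")
    case True
    then show ?thesis using eq g(2) p0 by auto
  next
    case False
    then have "g \<in> polys_le (N - 1)" using g(2) by simp
    moreover have "N - 1 < N" "N - 1 < n" using False less.prems by auto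
    ultimately obtain r1 where r1: "polyfun r1" "\<And>z. LT_operator \<gamma> \<kappa> r1 z - ev n * r1 z = g z"
      using less.IH by meson
    have "LT_operator \<gamma> \<kappa> (\<lambda>z. r0 z - r1 z) z - ev n * (r0 z - r1 z) = q z" for z
      unfolding lin_minus[OF lin_LT_operator p0 r1(1)]
      using eq[of z] r1(2)[of z] by (simp add: right_diff_distrib)
    then show ?thesis using real_polynomial_function_diff[OF p0 r1(1)]
      by (intro exI[of _ "\<lambda>z. r0 z - r1 z"] conjI allI)
  qed
qed

text \<open>A square of integral zero vanishes almost everywhere, hence on the interior of the domain by
  continuity and positivity of the weight there, hence identically.\<close>
lemma I_square_zero:
  assumes w: "polyfun w" and "I (\<lambda>z. w z * w z) = 0"
  shows "w = (\<lambda>z. 0)"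
proof -
  let ?g = "\<lambda>z. indicator LT_domain z * (w z * w z * LT_weight \<gamma> \<kappa> z)"
  have "integrable lborel ?g"
    using integrable_polyfun[of "\<lambda>z. w z * w z"] w
        by (simp add: set_integrable_def real_polynomial_function.intros(4))
  moreover have "integral\<^sup>L lborel ?g = 0"
    using assms(2) by (simp add: I_def set_lebesgue_integral_def)
  ultimately have AE: "AE z in lborel. ?g z = 0"
    by (subst (asm) integral_nonneg_eq_0_iff_AE)
        (auto intro!: mult_nonneg_nonneg simp: LT_weight_nonneg)
  define U where "U = {z :: ('m, 'n) dom. (\<forall>i. 0 < fst z $ i) \<and> (\<forall>j. 0 < snd z $ j) \<and> entry_sum
      (snd z) < 1}"
  have "open U"
  proof -
    have "U = (\<Inter>i. {z. 0 < fst z $ i}) \<inter> (\<Inter>j. {z. 0 < snd z $ j}) \<inter> {z. (\<Sum>j\<in>UNIV. snd z $ j) < 1}"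
      by (auto simp: U_def entry_sum_def)
    also have "open \<dots>"
      by (intro open_Int open_INT ballI finite open_Collect_less continuous_intros)
    finally show ?thesis .
  qed
  have cw: "continuous_on UNIV w"
    using w by (simp add: continuous_on_polymonial_function real_polynomial_function_eq)
  define S where "S = U \<inter> {z. w z \<noteq> 0}"
  have "open S" unfolding S_def
    by (intro open_Int \<open>open U\<close> open_Collect_neq cw continuous_intros)
  have pos: "LT_weight \<gamma> \<kappa> z > 0" "z \<in> LT_domain" if "z \<in> U" for z
  proof -
    have 1: "fst z $ i \<noteq> 0" "snd z $ j \<noteq> 0" "1 - entry_sum (snd z) \<noteq> 0" for i j
      using that by (auto simp: U_def) (metis less_irrefl)+
    then show "LT_weight \<gamma> \<kappa> z > 0"
      by (auto simp: LT_weight_def case_prod_beta intro!: mult_pos_pos prod_pos)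
    show "z \<in> LT_domain" using that by (cases z)
        (auto simp: U_def LT_domain_def simplex_set_def less_imp_le)
  qed
  have "AE z in lborel. z \<notin> S"
    using AE
  proof eventually_elim
    case (elim z)
    then show ?case using pos[of z] by (auto simp: S_def)
  qed
  then have "S \<in> null_sets lborel" using \<open>open S\<close> by (subst AE_iff_null_sets) auto
  then have "negligible S" by (simp add: negligible_iff_null_sets null_sets_completionI)
  then have "S = {}" using open_not_negligible \<open>open S\<close> by blast
  then have zU: "w z = 0" if "z \<in> U" for z using that by (auto simp: S_def)
  have "((\<chi> i. 1), (\<chi> j. 1 / (real CARD('n) + 1))) \<in> U"
    by (auto simp: U_def entry_sum_def field_simps)
  from zero_polynomial_if_zero_on_open[OF w \<open>open U\<close> this zU] show ?thesis by auto
qed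

lemma I_minus_ev_symmetric:
  assumes "polyfun u" "polyfun r"
  shows "I (\<lambda>z. u z * (LT_operator \<gamma> \<kappa> r z - c * r z))
      = I (\<lambda>z. (LT_operator \<gamma> \<kappa> u z - c * u z) * r z)"
proof -
  have p: "polyfun (LT_operator \<gamma> \<kappa> u)" "polyfun (LT_operator \<gamma> \<kappa> r)"
    using assms by (simp_all add: lin_poly[OF lin_LT_operator])
  have "I (\<lambda>z. u z * (LT_operator \<gamma> \<kappa> r z - c * r z))
      = I (\<lambda>z. LT_operator \<gamma> \<kappa> r z * u z - c * (u z * r z))"
    by (simp add: algebra_simps)
  also have "\<dots> = I (\<lambda>z. LT_operator \<gamma> \<kappa> r z * u z) - c * I (\<lambda>z. u z * r z)"
    by (simp add: lin_form_diff[OF lin_form_I] lin_form_cmult[OF lin_form_I]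
        real_polynomial_function.intros(2-4) assms p)
  also have "\<dots> = I (\<lambda>z. LT_operator \<gamma> \<kappa> u z * r z - c * (u z * r z))"
    by (simp add: lin_form_diff[OF lin_form_I] lin_form_cmult[OF lin_form_I]
        real_polynomial_function.intros(2-4) assms p LT_operator_symmetric[OF assms])
  finally show ?thesis by (simp add: algebra_simps)
qed

lemma orth_polys_iff:
  "u \<in> orth_polys n LT_domain (LT_weight \<gamma> \<kappa>) \<longleftrightarrow>
     (u = (\<lambda>z. 0) \<or> polyfun u \<and> total_degree u = n) \<and>
     (\<forall>q. polyfun q \<and> total_degree q < n \<longrightarrow> I (\<lambda>z. u z * q z) = 0)"
  by (simp add: orth_polys_def I_def)

text \<open>The lower-order remainder \<open>w\<close> of $Du$ is orthogonal to itself: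
  $I(w^2) = I\big((D - \mathit{ev}_n)u\cdot w\big) = I\big(u\cdot(D-\mathit{ev}_n)w\big) = 0$, as
  $(D-\mathit{ev}_n)w$ has degree less than $n$.\<close>
lemma LT_operator_orth_polys:
  assumes "u \<in> orth_polys n LT_domain (LT_weight \<gamma> \<kappa>)"
  shows "polyfun u" "LT_operator \<gamma> \<kappa> u = (\<lambda>z. ev n * u z)"
proof -
  have u: "u = (\<lambda>z. 0) \<or> polyfun u \<and> total_degree u = n"
    and orth: "\<And>q. polyfun q \<Longrightarrow> total_degree q < n \<Longrightarrow> I (\<lambda>z. u z * q z) = 0"
    using assms by (auto simp: orth_polys_iff)
  show p: "polyfun u" using u by (auto intro: real_polynomial_function.intros)
  have un: "u \<in> polys_le n" using u polys_le_total_degree polys_le_zero by auto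
  obtain w where w: "\<And>z. LT_operator \<gamma> \<kappa> u z = ev n * u z + w z" "if n = 0 then w
      = (\<lambda>z. 0) else w \<in> polys_le (n - 1)"
    using LT_operator_eigenvalue_plus_lower[OF un] by metis
  have "w = (\<lambda>z. 0)"
  proof (cases "n = 0")
    case False
    then have wn: "w \<in> polys_le (n - 1)" using w by simp
    then have pw: "polyfun w" by (rule polys_le_polyfun)
    obtain g where g: "\<And>z. LT_operator \<gamma> \<kappa> w z = ev (n - 1) * w z + g z" "if n - 1 = 0 then g
        = (\<lambda>z. 0) else g \<in> polys_le (n - 1 - 1)"
      using LT_operator_eigenvalue_plus_lower[OF wn] by metis
    have "g \<in> polys_le (n - 1)" using g(2) polys_le_zero polys_le_mono[of g "n - 1 - 1" "n - 1"]
        by (auto split: if_splits)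
    then have "(\<lambda>z. LT_operator \<gamma> \<kappa> w z - ev n * w z) \<in> polys_le (n - 1)"
      unfolding g(1) using wn by (intro polys_le_diff polys_le_add polys_le_cmult)
    from orth[OF polys_le_polyfun[OF this]] total_degree_le[OF this] False
    have "I (\<lambda>z. u z * (LT_operator \<gamma> \<kappa> w z - ev n * w z)) = 0" by simp
    then have "I (\<lambda>z. w z * w z) = 0"
      unfolding I_minus_ev_symmetric[OF p pw] by (simp add: w(1))
    with pw show ?thesis by (rule I_square_zero)
  qed (use w in simp)
  then show "LT_operator \<gamma> \<kappa> u = (\<lambda>z. ev n * u z)" using w(1) by auto
qed

text \<open>The degree is right because the diagonal entries of $D$ are distinct. Orthogonality to $q$
  follows from writing $q = (D-\mathit{ev}_n)r$ and moving the operator to $u$.\<close>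
lemma eigenpoly_in_orth_polys:
  assumes p: "polyfun u" and e: "LT_operator \<gamma> \<kappa> u = (\<lambda>z. ev n * u z)"
  shows "u \<in> orth_polys n LT_domain (LT_weight \<gamma> \<kappa>)"
  unfolding orth_polys_iff
proof (intro conjI allI impI)
  define N where "N = total_degree u"
  have uN: "u \<in> polys_le N" unfolding N_def using p by (rule polys_le_total_degree)
  obtain w where w: "\<And>z. LT_operator \<gamma> \<kappa> u z = ev N * u z + w z" "if N = 0 then w
      = (\<lambda>z. 0) else w \<in> polys_le (N - 1)"
    using LT_operator_eigenvalue_plus_lower[OF uN] by metis
  show "u = (\<lambda>z. 0) \<or> polyfun u \<and> total_degree u = n"
  proof (cases "N = n")
    case False
    then have ne: "ev n - ev N \<noteq> 0" using ev_inj by simp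
    have u: "u = (\<lambda>z. (1 / (ev n - ev N)) * w z)"
      using w(1) ne unfolding e by (auto simp: field_simps fun_eq_iff)
    show ?thesis
    proof (cases "N = 0")
      case True
      then show ?thesis using u w(2) by simp
    next
      case False
      then have "w \<in> polys_le (N - 1)" using w(2) by simp
      then have "u \<in> polys_le (N - 1)" by (subst u) (rule polys_le_cmult)
      from total_degree_le[OF this] False show ?thesis by (simp add: N_def)
    qed
  qed (use p N_def in simp)
next
  fix q :: "('m, 'n) dom \<Rightarrow> real" assume q: "polyfun q \<and> total_degree q < n"
  then obtain r where r: "polyfun r" "\<And>z. LT_operator \<gamma> \<kappa> r z - ev n * r z = q z"
    using ex_resolvent[OF polys_le_total_degree[of q], of n] by auto
  have "I (\<lambda>z. u z * q z) = I (\<lambda>z. (LT_operator \<gamma> \<kappa> u z - ev n * u z) * r z)"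
    using I_minus_ev_symmetric[OF p r(1), of "ev n"] by (simp add: r(2))
  also have "\<dots> = 0" by (simp add: e I_def)
  finally show "I (\<lambda>z. u z * q z) = 0" .
qed

end

theorem theorem6p4:
  fixes \<gamma> :: "real ^ 'm::finite"
    and \<kappa> :: "real ^ ('n::finite option)"
    and n :: nat
  assumes "\<forall>i. \<gamma> $ i > -1"
    and "\<forall>j. \<kappa> $ j > -1"
  shows "let V = orth_polys n LT_domain (LT_weight \<gamma> \<kappa>);
             ev = - real n * (real n + entry_sum \<kappa> + entry_sum \<gamma> + real CARD('m) + real CARD('n))
         in V = {u. real_polynomial_function u \<and> LT_operator \<gamma> \<kappa> u = (\<lambda>z. ev * u z)}
          \<and> (\<forall>u\<in>V. LT_operator \<gamma> \<kappa> u = (\<lambda>z. ev * u z))"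
proof -
  interpret laguerre_simplex \<gamma> \<kappa> using assms by unfold_locales
  let ?V = "orth_polys n LT_domain (LT_weight \<gamma> \<kappa>)"
  have ev: "- real n * (real n + entry_sum \<kappa> + entry_sum \<gamma> + real CARD('m) + real CARD('n)) = ev n"
    by (simp add: ev_def l_def algebra_simps)
  have eig: "LT_operator \<gamma> \<kappa> u = (\<lambda>z. ev n * u z)" if "u \<in> ?V" for u
    using that by (rule LT_operator_orth_polys(2))
  have "?V = {u. real_polynomial_function u \<and> LT_operator \<gamma> \<kappa> u = (\<lambda>z. ev n * u z)}"
  proof (intro set_eqI iffI CollectI conjI)
    fix u assume "u \<in> ?V"
    then show "real_polynomial_function u" "LT_operator \<gamma> \<kappa> u = (\<lambda>z. ev n * u z)"
      by (rule LT_operator_orth_polys)+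
  next
    fix u assume "u \<in> {u. real_polynomial_function u \<and> LT_operator \<gamma> \<kappa> u = (\<lambda>z. ev n * u z)}"
    then show "u \<in> ?V" by (intro eigenpoly_in_orth_polys) simp_all
  qed
  with eig show ?thesis unfolding Let_def ev by (intro conjI ballI)
qed

end
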